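(* Let $q$ be a prime power and $n\in\{2,3,4\}$. Suppose $Im\,(f(x)/x)=Im\,(g(x)/x)$ for some $q$-polynomials $f,g$ over $\mathbb{F}_{q^n}$, both with maximum field of linearity $\mathbb{F}_q$. Then there exist $\varphi\in \mathrm{GL}(2,q^n)$ and $\lambda \in \mathbb{F}_{q^n}^*$ such that the following holds. (i) If $n=2$, then $f_\varphi(x) = x^q$ and $g(x) = f(\lambda x)/\lambda$. (ii) If $n=3$, then either $f_\varphi(x)=\mathrm{Tr}(x)$ and $g(x)=f(\lambda x)/\lambda$, or $f_\varphi(x) = x^q$ and ($g(x)=f(\lambda x)/\lambda$ or $g(x)=\hat{f}(\lambda x)/\lambda$). (iii) If $n=4$, then $g(x) = f(\lambda x)/\lambda$ or $g(x) = \hat{f}(\lambda x)/\lambda$.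
   Context: A $q$-polynomial over $\mathbb{F}_{q^n}$ is a polynomial $f(x)=\sum_{i=0}^{n-1}a_ix^{q^i}$ with coefficients in $\mathbb{F}_{q^n}$; $Im\,(f(x)/x)=\{f(x)/x : x\in\mathbb{F}_{q^n}^*\}$. The adjoint is $\hat f(x)=\sum_{i=0}^{n-1}a_i^{q^{n-i}}x^{q^{n-i}}$ (with $x^{q^n}$ read as $x$). $\mathrm{Tr}(x)=x+x^q+\dots+x^{q^{n-1}}$. The maximum field of linearity of $f$ is the largest subfield $\mathbb{F}_{q^m}$ of $\mathbb{F}_{q^n}$ such that $f(\mu x)=\mu f(x)$ for all $\mu\in\mathbb{F}_{q^m}$, $x\in\mathbb{F}_{q^n}$. For $\varphi\in\mathrm{GL}(2,q^n)$ with matrix $\begin{pmatrix}a&b\\c&d\end{pmatrix}$, if $k_f(x)=ax+bf(x)$ is a bijection of $\mathbb{F}_{q^n}$, then $f_\varphi$ denotes the $q$-polynomial $h_f\circ k_f^{-1}$ where $h_f(x)=cx+df(x)$; i.e. the graph of $f_\varphi$ is the image under $\varphi$ of the graph $\{(x,f(x))\}$ of $f$. *)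

theory Defs
  imports
    "HOL-Analysis.Cartesian_Space"
    "HOL-Computational_Algebra.Polynomial"
    "HOL-Number_Theory.Prime_Powers"
begin

text \<open>
  The field of order \<open>q ^ n\<close> is rendered as a type \<open>'a :: {field, finite}\<close> with
  \<open>CARD('a) = q ^ n\<close>; statements about it assume this equation explicitly.
\<close>

definition qpoly :: "nat \<Rightarrow> nat \<Rightarrow> 'a::field poly \<Rightarrow> bool" where
  "qpoly q n f \<longleftrightarrow> (\<exists>a. f = (\<Sum>i<n. monom (a i) (q ^ i)))"

definition Im_quot :: "'a::field poly \<Rightarrow> 'a set" where
  "Im_quot f = {poly f x / x |x. x \<noteq> 0}"

text \<open>
  The exponent \<open>q ^ ((n - i) mod n)\<close> implements the convention that \<open>x ^ (q ^ n)\<close>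
  is read as \<open>x\<close>: it is \<open>1\<close> for \<open>i = 0\<close> and \<open>q ^ (n - i)\<close> for \<open>0 < i < n\<close>.
\<close>

definition adjoint_qpoly :: "nat \<Rightarrow> nat \<Rightarrow> 'a::field poly \<Rightarrow> 'a poly" where
  "adjoint_qpoly q n f =
     (\<Sum>i<n. monom (coeff f (q ^ i) ^ (q ^ (n - i))) (q ^ ((n - i) mod n)))"

definition Tr :: "nat \<Rightarrow> nat \<Rightarrow> 'a::field \<Rightarrow> 'a" where
  "Tr q n x = (\<Sum>i<n. x ^ (q ^ i))"

definition is_subfield :: "'a::field set \<Rightarrow> bool" where
  "is_subfield K \<longleftrightarrow> 0 \<in> K \<and> 1 \<in> K \<and>
     (\<forall>x\<in>K. \<forall>y\<in>K. x + y \<in> K \<and> x * y \<in> K) \<and>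
     (\<forall>x\<in>K. - x \<in> K \<and> inverse x \<in> K)"

definition linearity_field :: "nat \<Rightarrow> 'a::field poly \<Rightarrow> 'a set \<Rightarrow> bool" where
  "linearity_field q f K \<longleftrightarrow> is_subfield K \<and> (\<exists>m. card K = q ^ m) \<and>
     (\<forall>\<mu>\<in>K. \<forall>x. poly f (\<mu> * x) = \<mu> * poly f x)"

definition max_linearity_field :: "nat \<Rightarrow> 'a::field poly \<Rightarrow> 'a set \<Rightarrow> bool" where
  "max_linearity_field q f K \<longleftrightarrow>
     linearity_field q f K \<and> (\<forall>L. linearity_field q f L \<longrightarrow> L \<subseteq> K)"

definition k_map :: "'a::field ^ 2 ^ 2 \<Rightarrow> 'a poly \<Rightarrow> 'a \<Rightarrow> 'a" where
  "k_map \<phi> f x = \<phi> $ 1 $ 1 * x + \<phi> $ 1 $ 2 * poly f x"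

definition h_map :: "'a::field ^ 2 ^ 2 \<Rightarrow> 'a poly \<Rightarrow> 'a \<Rightarrow> 'a" where
  "h_map \<phi> f x = \<phi> $ 2 $ 1 * x + \<phi> $ 2 $ 2 * poly f x"

text \<open>
  \<open>f\<^sub>\<phi>\<close> is a partial notion, so it is rendered as a relation: \<open>transforms_to \<phi> f F\<close> says
  that \<open>f\<^sub>\<phi>\<close> is defined and that \<open>F\<close> is the map it induces.
\<close>

definition transforms_to :: "'a::field ^ 2 ^ 2 \<Rightarrow> 'a poly \<Rightarrow> ('a \<Rightarrow> 'a) \<Rightarrow> bool" where
  "transforms_to \<phi> f F \<longleftrightarrow> bij (k_map \<phi> f) \<and> F = h_map \<phi> f \<circ> inv (k_map \<phi> f)"

text \<open>
  Identities between \<open>q\<close>-polynomials are stated pointwise. Nothing is lost, since a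
  \<open>q\<close>-polynomial has degree less than \<open>q ^ n\<close>:
\<close>

lemma qpoly_eqI:
  fixes f g :: "'a::{field,finite} poly"
  assumes "primepow q" "0 < n" "CARD('a) = q ^ n" "qpoly q n f" "qpoly q n g"
    and "\<And>x. poly f x = poly g x"
  shows "f = g"
proof -
  have "q > 1" using primepow_gt_Suc_0 assms(1) by simp
  have *: "degree p < CARD('a)" if p: "qpoly q n p" for p :: "'a poly"
  proof -
    obtain a where p: "p = (\<Sum>i<n. monom (a i) (q ^ i))" using p unfolding qpoly_def by blast
    have "degree p \<le> q ^ (n - 1)"
      unfolding p
    proof (rule degree_sum_le)
      fix i assume "i \<in> {..<n}"
      then have "q ^ i \<le> q ^ (n - 1)" using \<open>q > 1\<close> by (intro power_increasing) auto
      then show "degree (monom (a i) (q ^ i)) \<le> q ^ (n - 1)"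
        using degree_monom_le order_trans by blast
    qed simp
    also have "\<dots> < q ^ n" using \<open>q > 1\<close> \<open>0 < n\<close> by (intro power_strict_increasing) auto
    finally show ?thesis using assms(3) by simp
  qed
  show ?thesis by (rule poly_eqI_degree[of UNIV]) (use assms * in auto)
qed

end

(*
  For a q-polynomial f with coefficients a_i, the values f(x)/x with x \<noteq> 0 are the t for which
  x \<mapsto> t x - f(x) is singular, that is, the roots of the determinant D_f(t) of its n \<times> n Dickson
  matrix. Frobenius permutes rows and columns of that matrix cyclically, so the values of D_f lie
  in F_q. Hence, if f and g have the same image set, D_f^(q-1) and D_g^(q-1) agree as functions,
  and by degree (q-1)(1 + q + ... + q^(n-1)) = q^n - 1 as polynomials. Both D_f and D_g are monic of
  the same degree, so u = D_f - D_g has lower degree than D_g, while raising D_f = D_g + u to the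
  q-th power gives u^q = u D_g^(q-1). Thus u = 0 and D_f = D_g: the sums of principal minors that
  appear as coefficients are determined by the image set.

  For n \<le> 4 these invariants suffice. Given u with b_1 = a_1 u and a_(n-1)^q = u b_(n-1)^q, the
  remaining equations take the form A + B = A z + B / z, whose solutions z = 1 and z = B / A
  correspond to f and to its adjoint. In each case the resulting multiplier
  u has norm 1, and Hilbert 90 provides \<lambda> with u = \<lambda>^(q-1).
*)

theory Submission
  imports
    Defs
    "HOL-Analysis.Determinants"
    "Jordan_Normal_Form.Determinant"
begin

section \<open>Finite fields\<close>

text \<open>Multiplication by a nonzero \<open>x\<close> permutes the nonzero elements; comparing
  their products shows that the order of \<open>x\<close> divides their number.\<close>

lemma power_card_field:
  fixes x :: "'a :: {field,finite}"
  shows "x ^ CARD('a) = x"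
proof (cases "x = 0")
  case False
  have "(\<Prod>y\<in>-{0}. y) = (\<Prod>y\<in>-{0}. x * y)"
    by (rule prod.reindex_bij_witness[of _ "\<lambda>y. x * y" "\<lambda>y. y / x"]) (use False in auto)
  also have "\<dots> = x ^ card (-{0::'a}) * (\<Prod>y\<in>-{0}. y)"
    by (simp add: prod.distrib)
  finally have "x ^ card (-{0::'a}) = 1"
    by simp
  moreover have "CARD('a) = Suc (card (-{0::'a}))"
    using card_Suc_Diff1[of UNIV "0::'a"] by (simp add: Compl_eq_Diff_UNIV)
  ultimately show ?thesis
    by simp
qed simp

text \<open>Translation by 1 permutes the field; comparing sums of all elements shows that
  \<open>p ^ k\<close> vanishes in it.\<close>

lemma CHAR_eq_prime:
  fixes F :: "'a :: {field,finite} itself"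
  assumes "prime p" "CARD('a) = p ^ k"
  shows "CHAR('a) = p"
proof -
  have "(\<Sum>y\<in>UNIV. y :: 'a) = (\<Sum>y\<in>UNIV. 1 + y)"
    by (rule sum.reindex_bij_witness[of _ "\<lambda>y. 1 + y" "\<lambda>y. y - 1"]) auto
  then have "of_nat (p ^ k) = (0 :: 'a)"
    by (simp add: sum.distrib assms(2))
  then have "of_nat p = (0 :: 'a)"
    by simp
  then have "CHAR('a) dvd p"
    by (simp add: of_nat_eq_0_iff_char_dvd)
  then show ?thesis
    using assms(1) by (metis CHAR_not_1' One_nat_def prime_nat_iff)
qed

section \<open>Determinants and polynomials\<close>

lemma coeff_linear_power_subleading:
  "coeff ([:c, 1:] ^ Suc m) m = (of_nat (Suc m) * c :: 'a :: comm_semiring_1)"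
proof (induction m)
  case (Suc m)
  have "coeff ([:c, 1:] ^ Suc (Suc m)) (Suc m)
      = c * coeff ([:c, 1:] ^ Suc m) (Suc m) + coeff ([:c, 1:] ^ Suc m) m"
    by (subst power_Suc) (simp del: power_Suc)
  then show ?case
    by (simp only: Suc.IH coeff_linear_power) (simp add: algebra_simps)
qed simp

lemma det_mat_2:
  fixes f :: "nat \<times> nat \<Rightarrow> 'a :: comm_ring_1"
  shows "det (mat 2 2 f) = f (0, 0) * f (1, 1) - f (0, 1) * f (1, 0)"
  by (subst laplace_expansion_row[of _ 2 0], simp, simp)
    (simp add: cofactor_def mat_delete_def numeral_2_eq_2 det_single)

lemma det_mat_3:
  fixes f :: "nat \<times> nat \<Rightarrow> 'a :: comm_ring_1"
  shows "det (mat 3 3 f)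
    = f (0, 0) * (f (1, 1) * f (2, 2) - f (1, 2) * f (2, 1))
    - f (0, 1) * (f (1, 0) * f (2, 2) - f (1, 2) * f (2, 0))
    + f (0, 2) * (f (1, 0) * f (2, 1) - f (1, 1) * f (2, 0))"
proof -
  have "{..<3} = {0, 1, 2 :: nat}"
    by auto
  then show ?thesis
    by (subst laplace_expansion_row[of _ 3 0], simp, simp)
      (simp add: cofactor_def mat_delete_def det_mat_2[simplified] Suc_1,
       simp add: numeral_2_eq_2 algebra_simps)
qed

lemma det_mat_4:
  fixes f :: "nat \<times> nat \<Rightarrow> 'a :: comm_ring_1"
  shows "det (mat 4 4 f)
    = f (0, 0) * det (mat 3 3 (\<lambda>(i, j). f (i + 1, j + 1)))
    - f (0, 1) * det (mat 3 3 (\<lambda>(i, j). f (i + 1, if j = 0 then 0 else j + 1)))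
    + f (0, 2) * det (mat 3 3 (\<lambda>(i, j). f (i + 1, if j = 2 then 3 else j)))
    - f (0, 3) * det (mat 3 3 (\<lambda>(i, j). f (i + 1, j)))"
proof -
  have *: "{..<4} = {0, 1, 2, 3 :: nat}"
    by auto
  show ?thesis
    by (subst laplace_expansion_row[of _ 4 0], simp, simp)
      (simp add: * cofactor_def mat_delete_def det_mat_3,
       simp add: numeral_2_eq_2 numeral_3_eq_3 algebra_simps)
qed

text \<open>Here and for sizes 3 and 4 the exponents are superincreasing, so distinct sets of
  diagonal positions give distinct degrees. The coefficient at the sum of \<open>e i\<close> over a
  set is then the principal minor, with zero diagonal, on the complementary indices.\<close>

lemma coeffs_det_2:
  fixes c :: "nat \<Rightarrow> nat \<Rightarrow> 'a :: comm_ring_1" and e :: "nat \<Rightarrow> nat"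
  assumes "0 < e 0" "e 0 < e 1"
  shows "coeff (det (mat 2 2 (\<lambda>(i, j). if i = j then monom 1 (e i) else - [:c i j:]))) 0 = - (c 0 1 * c 1 0)"
  using assms by (simp add: det_mat_2 mult_monom flip: monom_0)

lemma coeffs_det_3:
  fixes c :: "nat \<Rightarrow> nat \<Rightarrow> 'a :: comm_ring_1" and e :: "nat \<Rightarrow> nat"
  assumes "0 < e 0" "e 0 < e 1" "e 0 + e 1 < e 2"
  defines "P \<equiv> det (mat 3 3 (\<lambda>(i, j). if i = j then monom 1 (e i) else - [:c i j:]))"
  shows "coeff P (e 2) = - (c 0 1 * c 1 0)"
    and "coeff P 0 = - (c 0 1 * c 1 2 * c 2 0 + c 0 2 * c 2 1 * c 1 0)"
  using assms by (simp_all add: P_def det_mat_3 mult_monom algebra_simps flip: monom_0)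

text \<open>Only derangements reach the constant coefficient: double transpositions with sign plus,
  4-cycles with sign minus.\<close>

lemma coeffs_det_4:
  fixes c :: "nat \<Rightarrow> nat \<Rightarrow> 'a :: comm_ring_1" and e :: "nat \<Rightarrow> nat"
  assumes "0 < e 0" "e 0 < e 1" "e 0 + e 1 < e 2" "e 0 + e 1 + e 2 < e 3"
  defines "P \<equiv> det (mat 4 4 (\<lambda>(i, j). if i = j then monom 1 (e i) else - [:c i j:]))"
  shows "coeff P (e 2 + e 3) = - (c 0 1 * c 1 0)"
    and "coeff P (e 1 + e 3) = - (c 0 2 * c 2 0)"
    and "coeff P (e 3) = - (c 0 1 * c 1 2 * c 2 0 + c 0 2 * c 2 1 * c 1 0)"
    and "coeff P 0 = c 0 1 * c 1 0 * c 2 3 * c 3 2 + c 0 2 * c 2 0 * c 1 3 * c 3 1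
      + c 0 3 * c 3 0 * c 1 2 * c 2 1
      - (c 0 1 * c 1 2 * c 2 3 * c 3 0 + c 0 3 * c 3 2 * c 2 1 * c 1 0
       + c 0 1 * c 1 3 * c 3 2 * c 2 0 + c 0 2 * c 2 3 * c 3 1 * c 1 0
       + c 0 2 * c 2 1 * c 1 3 * c 3 0 + c 0 3 * c 3 1 * c 1 2 * c 2 0)"
  using assms unfolding P_def det_mat_4 det_mat_3
  by (simp_all add: mult_monom algebra_simps numeral_2_eq_2 numeral_3_eq_3 flip: monom_0)

text \<open>Clearing \<open>z\<close> makes the equation factor as
  \<open>(z - 1) * (A * z - B) = 0\<close>.\<close>

lemma add_eq_mult_add_divide:
  fixes A B z :: "'a :: field"
  assumes "A + B = A * z + B / z" "z \<noteq> 0"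
  shows "z = 1 \<or> A * z = B"
proof -
  have "(A + B) * z = A * z * z + B"
    unfolding assms(1) using assms(2) by (simp add: field_simps)
  then have "(z - 1) * (A * z - B) = 0"
    by (simp add: algebra_simps)
  then show ?thesis
    by auto
qed

text \<open>By \<open>eq\<close> the matrix carries the graph of \<open>f\<close> into the graph of
  \<open>F\<close>. If the first coordinate of an image vanishes, so does the second, and the
  nonzero determinant forces the preimage to vanish. Finiteness turns this injectivity of
  \<open>k_map\<close> into bijectivity.\<close>

lemma ex_transforms_toI:
  fixes f :: "'a :: {field,finite} poly"
  assumes diff: "\<And>x y. poly f (x - y) = poly f x - poly f y" and "F 0 = 0"
    and eq: "\<And>x. c * x + d * poly f x = F (a * x + b * poly f x)"
    and det: "a * d - b * c \<noteq> 0"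
  shows "\<exists>\<phi> :: 'a ^ 2 ^ 2. invertible \<phi> \<and> transforms_to \<phi> f F"
proof -
  define \<phi> :: "'a ^ 2 ^ 2" where "\<phi> = vector [vector [a, b], vector [c, d]]"
  have k: "k_map \<phi> f x = a * x + b * poly f x" and h: "h_map \<phi> f x = c * x + d * poly f x" for x
    by (simp_all add: k_map_def h_map_def \<phi>_def vector_2)
  have "inj (k_map \<phi> f)"
  proof (rule injI)
    fix x y
    assume "k_map \<phi> f x = k_map \<phi> f y"
    then have 1: "a * (x - y) + b * poly f (x - y) = 0"
      by (simp add: k diff algebra_simps)
    then have 2: "c * (x - y) + d * poly f (x - y) = 0"
      using eq[of "x - y"] \<open>F 0 = 0\<close> by simp
    have "(a * d - b * c) * (x - y)
        = d * (a * (x - y) + b * poly f (x - y)) - b * (c * (x - y) + d * poly f (x - y))"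
      by (simp add: algebra_simps)
    then show "x = y"
      using det unfolding 1 2 by simp
  qed
  then have bij: "bij (k_map \<phi> f)"
    by (simp add: bij_def finite_UNIV_inj_surj)
  have "h_map \<phi> f \<circ> Hilbert_Choice.inv (k_map \<phi> f) = F"
  proof
    fix y
    have "h_map \<phi> f x = F (k_map \<phi> f x)" for x
      by (simp add: k h eq)
    then show "(h_map \<phi> f \<circ> Hilbert_Choice.inv (k_map \<phi> f)) y = F y"
      using surj_f_inv_f[OF bij_is_surj[OF bij]] by simp
  qed
  moreover have "invertible \<phi>"
    using det by (simp add: invertible_det_nz det_2 \<phi>_def vector_2)
  ultimately show ?thesis
    using bij by (auto simp: transforms_to_def)
qed

section \<open>Frobenius maps\<close>

locale gf_extension =
  fixes q n :: nat and F :: "'a :: {field,finite} itself"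
  assumes primepow_q: "primepow q" and n_gt_1: "1 < n" and card_UNIV: "CARD('a) = q ^ n"
begin

lemma q_gt_1: "1 < q"
  using primepow_gt_Suc_0[OF primepow_q] by simp

lemma q_CHAR_power: "\<exists>k. q = CHAR('a) ^ k" "prime CHAR('a)"
proof -
  obtain p k where pk: "prime p" "q = p ^ k"
    using primepow_q by (auto simp: primepow_def)
  have "CHAR('a) = p"
    by (rule CHAR_eq_prime[of _ "k * n"]) (use pk card_UNIV in \<open>auto simp: power_mult\<close>)
  with pk show "\<exists>k. q = CHAR('a) ^ k" "prime CHAR('a)"
    by auto
qed

lemma power_q_poly_add: "(x + y :: 'a poly) ^ (q ^ i) = x ^ (q ^ i) + y ^ (q ^ i)"
  using q_CHAR_power freshmans_dream'[of "q ^ i" _ x y] by (auto simp flip: power_mult)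

text \<open>Indices are plain natural numbers: \<open>fr_fr\<close> reduces a composite modulo
  \<open>n\<close>, while \<open>fr_fr_add\<close> keeps the raw sum where telescoping needs
  it.\<close>

definition fr :: "nat \<Rightarrow> 'a \<Rightarrow> 'a" where
  "fr i x = x ^ (q ^ i)"

lemma fr_mult [simp]: "fr i (x * y) = fr i x * fr i y"
  and fr_1 [simp]: "fr i 1 = 1"
  and fr_0 [simp]: "fr i 0 = 0"
  and fr_0_left [simp]: "fr 0 x = x"
  and fr_inverse [simp]: "fr i (inverse x) = inverse (fr i x)"
  and fr_divide [simp]: "fr i (x / y) = fr i x / fr i y"
  and fr_eq_0_iff [simp]: "fr i x = 0 \<longleftrightarrow> x = 0"
  using q_gt_1 by (auto simp: fr_def power_mult_distrib power_inverse power_divide zero_power)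

lemma fr_add [simp]: "fr i (x + y) = fr i x + fr i y"
  unfolding fr_def using q_CHAR_power freshmans_dream'[of "q ^ i" _ x y] by (auto simp flip: power_mult)

lemma fr_minus [simp]: "fr i (- x) = - fr i x"
  using fr_add[of i x "-x"] by (simp add: eq_neg_iff_add_eq_0 del: fr_add) (simp add: add.commute)

lemma fr_diff [simp]: "fr i (x - y) = fr i x - fr i y"
  using fr_add[of i x "-y"] by (simp del: fr_add)

lemma fr_sum [simp]: "fr i (\<Sum>x\<in>A. f x) = (\<Sum>x\<in>A. fr i (f x))"
  by (induction A rule: infinite_finite_induct) auto

lemma fr_prod [simp]: "fr i (\<Prod>x\<in>A. f x) = (\<Prod>x\<in>A. fr i (f x))"
  by (induction A rule: infinite_finite_induct) auto

lemma fr_eq_iff [simp]: "fr i x = fr i y \<longleftrightarrow> x = y"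
  using fr_eq_0_iff[of i "x - y"] by (simp del: fr_eq_0_iff)

lemma fr_fr_add: "fr i (fr j x) = fr (i + j) x"
  by (simp add: fr_def power_add mult.commute flip: power_mult)

lemma fr_mod: "fr (i mod n) x = fr i x"
proof -
  have *: "fr (m * n) y = y" for m y
    by (induction m)
      (simp_all add: fr_fr_add[symmetric], simp add: fr_def power_card_field flip: card_UNIV)
  show ?thesis
    using fr_fr_add[of "i div n * n" "i mod n" x] by (simp add: *)
qed

lemma fr_n [simp]: "fr n x = x"
  using fr_mod[of n x] by simp

lemma fr_fr [simp]: "fr i (fr j x) = fr ((i + j) mod n) x"
  by (simp add: fr_mod fr_fr_add)

definition lin :: "(nat \<Rightarrow> 'a) \<Rightarrow> 'a \<Rightarrow> 'a" where
  "lin a x = (\<Sum>i<n. a i * fr i x)"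

text \<open>Linear independence of the Frobenius powers: the associated polynomial has degree below
  the order of the field, so it cannot vanish everywhere unless it is zero.\<close>

lemma lin_eq_0_imp:
  assumes "\<And>x. lin a x = 0" "k < n"
  shows "a k = 0"
proof -
  define p where "p = (\<Sum>i<n. monom (a i) (q ^ i))"
  have "degree p \<le> q ^ (n - 1)"
    unfolding p_def using q_gt_1
    by (intro degree_sum_le order.trans[OF degree_monom_le] power_increasing) auto
  also have "\<dots> < CARD('a)"
    using q_gt_1 n_gt_1 by (simp add: card_UNIV)
  finally have "p = 0"
    using assms by (intro poly_eqI_degree[of UNIV])
      (auto simp: p_def poly_sum poly_monom lin_def fr_def)
  then have "0 = coeff p (q ^ k)"
    by simp
  also have "\<dots> = (\<Sum>i<n. if i = k then a i else 0)"
    unfolding p_def coeff_sum using q_gt_1 by (intro sum.cong) auto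
  also have "\<dots> = a k"
    using assms(2) by simp
  finally show ?thesis
    by simp
qed

section \<open>Dickson matrices\<close>

text \<open>Row \<open>i\<close> applied to \<open>(x, fr 1 x, fr 2 x, ...)\<close> gives
  \<open>fr i (lin a x)\<close>. The summand \<open>n\<close> keeps the subtraction from
  truncating.\<close>

definition dickson :: "(nat \<Rightarrow> 'a) \<Rightarrow> 'a mat" where
  "dickson a = mat n n (\<lambda>(i, j). fr i (a ((n + j - i) mod n)))"

lemma dickson_carrier [simp]: "dickson a \<in> carrier_mat n n"
  by (simp add: dickson_def)

lemma mod_n_eq: "x < 2 * n \<Longrightarrow> x mod n = (if x < n then x else x - n)"
  by (auto simp: mod_if)

lemma sub_mod_eq_iff:
  assumes "i < n" "j < n" "k < n"
  shows "(n + j - i) mod n = k \<longleftrightarrow> j = (k + i) mod n"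
proof -
  show ?thesis
    using assms by (subst (1 2) mod_n_eq) auto
qed

lemma sum_shift:
  fixes g :: "nat \<Rightarrow> 'b :: comm_monoid_add"
  assumes "i < n"
  shows "(\<Sum>j<n. g ((n + j - i) mod n)) = (\<Sum>k<n. g k)"
    and "(\<Sum>j<n. g ((n + i - j) mod n)) = (\<Sum>k<n. g k)"
proof -
  show "(\<Sum>j<n. g ((n + j - i) mod n)) = (\<Sum>k<n. g k)"
    by (rule sum.reindex_bij_witness[of _ "\<lambda>k. (k + i) mod n" "\<lambda>j. (n + j - i) mod n"])
      (use assms in \<open>auto simp: mod_n_eq\<close>)
  show "(\<Sum>j<n. g ((n + i - j) mod n)) = (\<Sum>k<n. g k)"
    by (rule sum.reindex_bij_witness[of _ "\<lambda>k. (n + i - k) mod n" "\<lambda>j. (n + i - j) mod n"])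
      (use assms in \<open>auto simp: mod_n_eq\<close>)
qed

lemma det_dickson_eq_0_if_kernel:
  assumes "x \<noteq> 0" "lin a x = 0"
  shows "det (dickson a) = 0"
proof -
  define v where "v = vec n (\<lambda>j. fr j x)"
  have "(\<Sum>j<n. fr i (a ((n + j - i) mod n)) * fr j x) = 0" if "i < n" for i
  proof -
    have "(\<Sum>j<n. fr i (a ((n + j - i) mod n)) * fr j x)
        = (\<Sum>j<n. fr i (a ((n + j - i) mod n)) * fr (i + (n + j - i) mod n) x)"
    proof (rule sum.cong)
      fix j assume "j \<in> {..<n}"
      then have "(i + (n + j - i) mod n) mod n = j"
        using that sub_mod_eq_iff[of i j "(n + j - i) mod n"] by (simp add: add.commute)
      then show "fr i (a ((n + j - i) mod n)) * fr j x
          = fr i (a ((n + j - i) mod n)) * fr (i + (n + j - i) mod n) x"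
        by (metis fr_mod)
    qed simp
    also have "\<dots> = (\<Sum>k<n. fr i (a k) * fr (i + k) x)"
      by (rule sum_shift(1)[OF that])
    also have "\<dots> = fr i (lin a x)"
      by (simp add: lin_def fr_mod)
    finally show ?thesis
      using assms by simp
  qed
  then have "dickson a *\<^sub>v v = 0\<^sub>v n"
    by (intro eq_vecI) (auto simp: dickson_def v_def scalar_prod_def atLeast0LessThan)
  moreover have "v $ 0 \<noteq> 0"
    using assms n_gt_1 by (simp add: v_def)
  then have "v \<noteq> 0\<^sub>v n"
    using n_gt_1 by auto
  moreover have "v \<in> carrier_vec n"
    by (simp add: v_def)
  ultimately show ?thesis
    using det_0_iff_vec_prod_zero_field[OF dickson_carrier, of a] by blast
qed

text \<open>
  The kernel of the matrix is stable under the semilinear map that applies Frobenius and shifts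
  cyclically; the trace of a suitable multiple of a kernel vector is a nonzero fixed vector
  \<open>(x, x\<^sup>q, \<dots>)\<close>.
\<close>

lemma kernel_if_det_dickson_eq_0:
  assumes "det (dickson a) = 0"
  shows "\<exists>x. x \<noteq> 0 \<and> lin a x = 0"
proof -
  obtain v where v: "v \<in> carrier_vec n" "v \<noteq> 0\<^sub>v n" "dickson a *\<^sub>v v = 0\<^sub>v n"
    using assms det_0_iff_vec_prod_zero_field[OF dickson_carrier, of a] by blast
  have row: "(\<Sum>j<n. fr i (a ((n + j - i) mod n)) * v $ j) = 0" if "i < n" for i
  proof -
    have "(dickson a *\<^sub>v v) $ i = 0"
      using v(3) that by simp
    then show ?thesis
      using that v(1) by (simp add: dickson_def scalar_prod_def atLeast0LessThan)
  qed
  \<comment> \<open>With this \<open>b\<close>, \<open>lin b y\<close> is the zeroth coordinate of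
    the trace of \<open>y\<close> times \<open>v\<close> under the semilinear shift. As
    \<open>v\<close> is nonzero, so is some coefficient of \<open>b\<close>, and independence
    supplies a good \<open>y\<close>.\<close>
  define b where "b k = fr k (v $ ((n - k) mod n))" for k
  obtain j where j: "j < n" "v $ j \<noteq> 0"
    using v(1,2) by (metis carrier_vecD eq_vecI index_zero_vec)
  have "b ((n - j) mod n) \<noteq> 0"
    using j by (cases "j = 0") (auto simp: b_def)
  then obtain y where y: "lin b y \<noteq> 0"
    using lin_eq_0_imp[of b "(n - j) mod n"] j(1) by auto
  have x: "lin b y = (\<Sum>j<n. fr (n - j) (y * v $ j))"
    unfolding lin_def
  proof (rule sum.reindex_bij_witness[of _ "\<lambda>j. (n - j) mod n" "\<lambda>j. (n - j) mod n"])
    fix k assume k: "k \<in> {..<n}"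
    show "fr (n - (n - k) mod n) (y * v $ ((n - k) mod n)) = b k * fr k y"
      using k by (cases "k = 0") (auto simp: b_def mult.commute)
  qed (auto simp: mod_if)
  \<comment> \<open>Substituting \<open>k = j - i\<close> modulo \<open>n\<close> collects the terms
    into \<open>fr (n - i)\<close> of \<open>y\<close> times row \<open>i\<close> of the kernel
    equation.\<close>
  have "lin a (lin b y) = (\<Sum>k<n. \<Sum>j<n. a k * fr (k + (n - j)) (y * v $ j))"
    by (simp add: x lin_def[of a] fr_mod sum_distrib_left)
  also have "\<dots> = (\<Sum>j<n. \<Sum>k<n. a k * fr (k + (n - j)) (y * v $ j))"
    by (rule sum.swap)
  also have "\<dots> = (\<Sum>j<n. \<Sum>i<n. a ((n + j - i) mod n) * fr (n - i) (y * v $ j))"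
  proof (rule sum.cong)
    fix j assume j: "j \<in> {..<n}"
    have "(\<Sum>k<n. a k * fr (k + (n - j)) (y * v $ j))
        = (\<Sum>i<n. a ((n + j - i) mod n) * fr ((n + j - i) mod n + (n - j)) (y * v $ j))"
      using j by (intro sum_shift(2)[symmetric]) auto
    also have "\<dots> = (\<Sum>i<n. a ((n + j - i) mod n) * fr (n - i) (y * v $ j))"
    proof (rule sum.cong)
      fix i assume i: "i \<in> {..<n}"
      have "((n + j - i) mod n + (n - j)) mod n = (n + j - i + (n - j)) mod n"
        by (simp add: mod_simps)
      also have "n + j - i + (n - j) = (n - i) + n"
        using i j by auto
      finally have "((n + j - i) mod n + (n - j)) mod n = (n - i) mod n"
        by simp
      then have "fr ((n + j - i) mod n + (n - j)) z = fr (n - i) z" for z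
        by (metis fr_mod)
      then show "a ((n + j - i) mod n) * fr ((n + j - i) mod n + (n - j)) (y * v $ j)
          = a ((n + j - i) mod n) * fr (n - i) (y * v $ j)"
        by simp
    qed simp
    finally show "(\<Sum>k<n. a k * fr (k + (n - j)) (y * v $ j))
        = (\<Sum>i<n. a ((n + j - i) mod n) * fr (n - i) (y * v $ j))" .
  qed simp
  also have "\<dots> = (\<Sum>i<n. \<Sum>j<n. a ((n + j - i) mod n) * fr (n - i) (y * v $ j))"
    by (rule sum.swap)
  also have "\<dots> = (\<Sum>i<n. fr (n - i) (y * (\<Sum>j<n. fr i (a ((n + j - i) mod n)) * v $ j)))"
    by (intro sum.cong) (simp_all add: sum_distrib_left mult_ac)
  also have "\<dots> = 0"
    by (intro sum.neutral) (use row in auto)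
  finally show ?thesis
    using y by blast
qed

lemma det_dickson_power_q: "det (dickson a) ^ q = det (dickson a)"
proof -
  interpret comm_ring_hom "fr 1"
    by unfold_locales auto
  define c where "c i = (if i < n then (i + 1) mod n else i)" for i
  have c: "c permutes {0..<n}"
  proof (rule bij_imp_permutes)
    show "bij_betw c {0..<n} {0..<n}"
      by (rule bij_betw_byWitness[of _ "\<lambda>j. (n + j - 1) mod n"]) (auto simp: c_def mod_if)
  qed (auto simp: c_def)
  let ?D = "dickson a" and ?E = "mat n n (\<lambda>(i, j). dickson a $$ (c i, j))"
  have E: "?E \<in> carrier_mat n n"
    by simp
  have eq: "fr (c i) (a ((n + c j - c i) mod n)) = fr ((1 + i) mod n) (a ((n + j - i) mod n))"
    if ij: "i < n" "j < n" for i j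
  proof -
    have "c i = (1 + i) mod n"
      using ij by (simp add: c_def)
    moreover have "(n + c j - c i) mod n = (n + j - i) mod n"
      using ij n_gt_1 by (simp add: c_def mod_n_eq) linarith
    ultimately show ?thesis
      by simp
  qed
  \<comment> \<open>Frobenius shifts rows and columns at once. Transposing reduces the column shift
    to a row shift, and the two signs cancel.\<close>
  have "map_mat (fr 1) ?D = (mat n n (\<lambda>(i, j). ?E\<^sup>T $$ (c i, j)))\<^sup>T"
    by (rule eq_matI) (use eq in \<open>auto simp: dickson_def permutes_in_image[OF c, simplified]\<close>)
  then have "fr 1 (det ?D) = det ((mat n n (\<lambda>(i, j). ?E\<^sup>T $$ (c i, j)))\<^sup>T)"
    by (metis hom_det)
  also have "\<dots> = det (mat n n (\<lambda>(i, j). ?E\<^sup>T $$ (c i, j)))"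
    by (rule det_transpose[of _ n]) simp
  also have "\<dots> = signof c * det ?E\<^sup>T"
    by (rule det_permute_rows[OF _ c]) simp
  also have "\<dots> = signof c * (signof c * det ?D)"
    by (simp only: det_transpose[OF E] det_permute_rows[OF dickson_carrier c])
  also have "\<dots> = det ?D"
    by (simp add: sign_def)
  finally show ?thesis
    by (simp add: fr_def)
qed

section \<open>The Dickson polynomial: roots, degree and leading coefficients\<close>

definition dickson_poly :: "(nat \<Rightarrow> 'a) \<Rightarrow> 'a poly" where
  "dickson_poly a = det (mat n n (\<lambda>(i, j).
     (if i = j then monom 1 (q ^ i) else 0) - [:fr i (a ((n + j - i) mod n)):]))"

text \<open>The scalar \<open>t\<close> sits at index 0 of the sequence, so it meets the diagonal of
  row \<open>i\<close> as \<open>fr i t\<close>; hence the monomial of degree \<open>q ^ i\<close>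
  there.\<close>

lemma poly_dickson_poly:
  "poly (dickson_poly a) t = det (dickson (\<lambda>k. (if k = 0 then t else 0) - a k))"
proof -
  interpret comm_ring_hom "\<lambda>p. poly p t"
    by unfold_locales auto
  have "(n + j - i) mod n = 0 \<longleftrightarrow> i = j" if "i < n" "j < n" for i j
    using that sub_mod_eq_iff[of i j 0] by auto
  then have "map_mat (\<lambda>p. poly p t) (mat n n (\<lambda>(i, j).
        (if i = j then monom 1 (q ^ i) else 0) - [:fr i (a ((n + j - i) mod n)):]))
      = dickson (\<lambda>k. (if k = 0 then t else 0) - a k)"
    by (intro eq_matI) (auto simp: dickson_def poly_monom simp flip: fr_def)
  then show ?thesis
    by (simp only: dickson_poly_def hom_det[symmetric])
qed

lemma lin_diff_linear:
  "lin (\<lambda>k. (if k = 0 then t else 0) - a k) x = t * x - lin a x"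
proof -
  have "lin (\<lambda>k. (if k = 0 then t else 0) - a k) x
      = (\<Sum>k<n. if k = 0 then t * fr k x else 0) - lin a x"
    unfolding lin_def by (subst sum_subtractf[symmetric]) (auto intro!: sum.cong simp: left_diff_distrib)
  then show ?thesis
    using n_gt_1 by simp
qed

lemma poly_dickson_poly_eq_0_iff:
  "poly (dickson_poly a) t = 0 \<longleftrightarrow> t \<in> {lin a x / x |x. x \<noteq> 0}"
proof -
  have "poly (dickson_poly a) t = 0 \<longleftrightarrow> (\<exists>x. x \<noteq> 0 \<and> t * x - lin a x = 0)"
    unfolding poly_dickson_poly lin_diff_linear[symmetric]
    using det_dickson_eq_0_if_kernel kernel_if_det_dickson_eq_0 by blast
  also have "\<dots> \<longleftrightarrow> (\<exists>x. t = lin a x / x \<and> x \<noteq> 0)"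
    by (intro ex_cong1) (auto simp: field_simps)
  finally show ?thesis
    by simp
qed

text \<open>The degree of the Dickson polynomial, equal to
  \<open>(q ^ n - 1) / (q - 1)\<close>.\<close>

definition exp_sum :: nat where
  "exp_sum = (\<Sum>i<n. q ^ i)"

lemma sum_power_mult: "(\<Sum>i<m. q ^ i) * (q - 1) = q ^ m - 1"
proof -
  obtain r where r: "q = Suc r"
    using q_gt_1 by (cases q) auto
  have "(\<Sum>i<m. q ^ i) * (q - 1) + 1 = q ^ m"
    by (induction m) (simp_all add: r algebra_simps)
  then show ?thesis
    by simp
qed

lemma of_nat_q [simp]: "of_nat q = (0 :: 'a)"
proof -
  obtain k where k: "q = CHAR('a) ^ k"
    using q_CHAR_power by blast
  with q_gt_1 have "k \<noteq> 0"
    by (intro notI) simp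
  then show ?thesis
    by (subst k) simp
qed

lemma exp_sum_pos: "0 < exp_sum"
  unfolding exp_sum_def using n_gt_1 q_gt_1 by (intro sum_pos) auto

lemma of_nat_exp_sum [simp]: "of_nat exp_sum = (1 :: 'a)"
proof -
  have "{..<n} = insert 0 {1..<n}"
    using n_gt_1 by auto
  then show ?thesis
    by (simp add: exp_sum_def zero_power)
qed

lemma linear_power_q: "[:- c, 1:] ^ (q ^ i) = monom 1 (q ^ i) - [:fr i c:]"
proof -
  have "[:- c, 1:] = monom 1 1 + [:- c:]"
    by (simp add: monom_altdef)
  then have "[:- c, 1:] ^ (q ^ i) = monom 1 1 ^ (q ^ i) + [:- c:] ^ (q ^ i)"
    by (simp add: power_q_poly_add del: One_nat_def)
  also have "[:- c:] ^ (q ^ i) = [:fr i (- c):]"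
    by (simp add: fr_def poly_const_pow del: fr_minus)
  finally show ?thesis
    by (simp add: monom_power)
qed

text \<open>A permutation other than the identity moves at least two indices, so its term has degree
  at most \<open>exp_sum - 2\<close>. The identity contributes a product of powers of the single
  linear factor, by Freshman's dream.\<close>

lemma coeff_dickson_poly:
  assumes "exp_sum - 1 \<le> k"
  shows "coeff (dickson_poly a) k = coeff ([:- a 0, 1:] ^ exp_sum) k"
proof -
  define M where "M i j = (if i = j then monom 1 (q ^ i) else 0) - [:fr i (a ((n + j - i) mod n)):]" for i j
  define T where "T p = signof p * (\<Prod>i = 0..<n. M i (p i))" for p
  have "dickson_poly a = (\<Sum>p | p permutes {0..<n}. T p)"
    unfolding dickson_poly_def T_def M_def by (subst det_def'[of _ n]) (auto intro!: sum.cong prod.cong simp: permutes_in_image[of _ "{0..<n}", simplified])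
  then have "coeff (dickson_poly a) k = (\<Sum>p | p permutes {0..<n}. coeff (T p) k)"
    by (simp add: coeff_sum)
  also have "\<dots> = (\<Sum>p | p permutes {0..<n}. if p = id then coeff (T id) k else 0)"
  proof (rule sum.cong)
    fix p assume "p \<in> {p. p permutes {0..<n}}"
    then have p: "p permutes {0..<n}"
      by simp
    have "coeff (T p) k = 0" if ne: "p \<noteq> id"
    proof -
      obtain i where i: "p i \<noteq> i"
        using ne by (auto simp: fun_eq_iff)
      then have i_n: "i < n" "p i < n"
        using p permutes_not_in[OF p, of i] permutes_in_image[OF p, of i] by auto
      have pi: "p (p i) \<noteq> p i"
        using i permutes_inj[OF p] by (auto dest: injD)
      define e where "e i = (if p i = i then q ^ i else 0)" for i
      have le: "e i \<le> q ^ i" for i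
        by (simp add: e_def)
      have "{..<n} = insert i (insert (p i) ({..<n} - {i, p i}))"
        using i_n by auto
      then have split: "(\<Sum>j<n. f j) = f i + (f (p i) + (\<Sum>j\<in>{..<n} - {i, p i}. f j))" for f :: "nat \<Rightarrow> nat"
        using i by (metis (no_types, lifting) DiffE finite_Diff finite_insert finite_lessThan insert_iff sum.insert)
      have "(\<Sum>j<n. e j) = (\<Sum>j\<in>{..<n} - {i, p i}. e j)"
        unfolding split[of e] using i pi by (simp add: e_def)
      also have "\<dots> \<le> (\<Sum>j\<in>{..<n} - {i, p i}. q ^ j)"
        by (intro sum_mono le)
      finally have "(\<Sum>j<n. e j) + (q ^ i + q ^ p i) \<le> exp_sum"
        unfolding exp_sum_def split[of "\<lambda>j. q ^ j"] by simp
      moreover have "q ^ i + q ^ p i \<ge> 2"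
        using q_gt_1 zero_less_power[of q i] zero_less_power[of q "p i"] by linarith
      moreover have "degree (T p) \<le> (\<Sum>j<n. e j)"
      proof -
        have "degree (M j (p j)) \<le> e j" if "j < n" for j
          unfolding M_def e_def by (auto intro!: degree_diff_le degree_monom_le)
        then have "degree (\<Prod>i = 0..<n. M i (p i)) \<le> (\<Sum>j<n. e j)"
          by (intro order.trans[OF degree_prod_sum_le]) (auto intro!: sum_mono simp: atLeast0LessThan)
        then show ?thesis
          by (auto simp: T_def sign_def)
      qed
      ultimately have "degree (T p) < k"
        using assms by linarith
      then show ?thesis
        by (rule coeff_eq_0)
    qed
    then show "coeff (T p) k = (if p = id then coeff (T id) k else 0)"
      by simp
  qed simp
  also have "\<dots> = coeff (T id) k"
    by (simp add: finite_permutations permutes_id)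
  also have "T id = (\<Prod>i = 0..<n. [:- a 0, 1:] ^ (q ^ i))"
    by (simp add: T_def M_def linear_power_q)
  also have "\<dots> = [:- a 0, 1:] ^ exp_sum"
    by (simp add: exp_sum_def power_sum atLeast0LessThan)
  finally show ?thesis .
qed

lemma degree_dickson_poly: "degree (dickson_poly a) = exp_sum"
  and coeff_dickson_poly_exp_sum: "coeff (dickson_poly a) exp_sum = 1"
proof -
  show 1: "coeff (dickson_poly a) exp_sum = 1"
    by (simp add: coeff_dickson_poly coeff_linear_power)
  show "degree (dickson_poly a) = exp_sum"
  proof (rule antisym)
    show "degree (dickson_poly a) \<le> exp_sum"
      by (rule degree_le) (auto simp: coeff_dickson_poly coeff_eq_0 degree_linear_power)
  qed (simp add: 1 le_degree)
qed

text \<open>The binomial factor \<open>exp_sum\<close> is 1 in the field, so this coefficient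
  recovers \<open>a 0\<close>.\<close>

lemma coeff_dickson_poly_subleading: "coeff (dickson_poly a) (exp_sum - 1) = - a 0"
  using coeff_linear_power_subleading[of "- a 0" "exp_sum - 1"] exp_sum_pos
  by (simp add: coeff_dickson_poly del: power_Suc)

lemma dickson_poly_eqI:
  assumes "{lin a x / x |x. x \<noteq> 0} = {lin b x / x |x. x \<noteq> 0}"
  shows "dickson_poly a = dickson_poly b"
proof (rule ccontr)
  assume "dickson_poly a \<noteq> dickson_poly b"
  define p r u where "p = dickson_poly a" and "r = dickson_poly b" and "u = p - r"
  have u: "u \<noteq> 0"
    using \<open>dickson_poly a \<noteq> dickson_poly b\<close> by (simp add: p_def r_def u_def)
  have q: "Suc (q - 1) = q"
    using q_gt_1 by simp
  have power: "poly (dickson_poly c) t ^ (q - 1) = (if poly (dickson_poly c) t = 0 then 0 else 1)" for c t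
  proof -
    have "z ^ (q - 1) = (if z = 0 then 0 else 1)" if "z ^ q = z" for z :: 'a
      using that q_gt_1 power_Suc[of z "q - 1", unfolded q] by (auto simp: zero_power)
    then show ?thesis
      using det_dickson_power_q by (simp add: poly_dickson_poly)
  qed
  \<comment> \<open>The degree is at most \<open>q ^ n - 1\<close>, just small enough for values to
    determine the polynomial.\<close>
  have deg: "degree (dickson_poly c ^ (q - 1)) < CARD('a)" for c
  proof -
    have "degree (dickson_poly c ^ (q - 1)) \<le> exp_sum * (q - 1)"
      using degree_power_le[of "dickson_poly c" "q - 1"] by (simp add: degree_dickson_poly)
    also have "\<dots> < CARD('a)"
      unfolding exp_sum_def sum_power_mult card_UNIV using q_gt_1 by simp
    finally show ?thesis .
  qed
  have eq: "p ^ (q - 1) = r ^ (q - 1)"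
  proof (rule poly_eqI_degree[of UNIV])
    fix t
    have "poly p t = 0 \<longleftrightarrow> poly r t = 0"
      unfolding p_def r_def poly_dickson_poly_eq_0_iff assms ..
    then show "poly (p ^ (q - 1)) t = poly (r ^ (q - 1)) t"
      by (simp add: p_def r_def power del: One_nat_def)
  qed (use deg in \<open>auto simp: p_def r_def\<close>)
  have "r ^ q + u ^ q = p ^ q"
    using power_q_poly_add[of r u 1] by (simp add: u_def)
  also have "\<dots> = (r + u) * r ^ (q - 1)"
    using power_Suc[of p "q - 1", unfolded q] eq by (simp add: u_def del: One_nat_def)
  also have "\<dots> = r ^ q + u * r ^ (q - 1)"
    using power_Suc[of r "q - 1", unfolded q] by (simp add: distrib_right)
  finally have "u * u ^ (q - 1) = u * r ^ (q - 1)"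
    using power_Suc[of u "q - 1", unfolded q] by simp
  \<comment> \<open>Cancelling \<open>u\<close> leaves \<open>u ^ (q - 1) = r ^ (q - 1)\<close>, so
    \<open>u\<close> would have the degree of \<open>r\<close>, although the leading terms of the
    monic \<open>p\<close> and \<open>r\<close> cancel in \<open>u\<close>.\<close>
  then have "degree (u ^ (q - 1)) = degree (r ^ (q - 1))"
    using u by simp
  moreover have "dickson_poly b \<noteq> 0"
    using coeff_dickson_poly_exp_sum[of b] by auto
  ultimately have "degree u = exp_sum"
    using u q_gt_1 by (simp add: degree_power_eq r_def degree_dickson_poly)
  moreover have "coeff u exp_sum = 0"
    by (simp add: u_def p_def r_def coeff_dickson_poly_exp_sum)
  ultimately show False
    using u leading_coeff_0_iff by metis
qed

section \<open>Hilbert 90 and equivalence of coefficient sequences\<close>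

definition norm_F :: "'a \<Rightarrow> 'a" where
  "norm_F x = (\<Prod>i<n. fr i x)"

text \<open>The partial products \<open>c\<close> satisfy \<open>c (Suc k) = u * fr 1 (c k)\<close>
  and return to 1 at \<open>n\<close>. Independence gives a nonzero value \<open>x\<close> of
  \<open>lin c\<close>; the recursion yields \<open>u * fr 1 x = x\<close>, so \<open>1 / x\<close>
  works.\<close>

lemma hilbert90:
  assumes "norm_F u = 1"
  shows "\<exists>l. l \<noteq> 0 \<and> u = l ^ (q - 1)"
proof -
  define c where "c k = (\<Prod>j<k. fr j u)" for k
  have Suc: "c (Suc k) = u * fr 1 (c k)" for k
    by (simp add: c_def prod.lessThan_Suc_shift fr_fr_add del: fr_fr prod.lessThan_Suc)
  have c: "c 0 = 1" "c n = 1"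
    using assms by (simp_all add: c_def norm_F_def)
  obtain y where y: "lin c y \<noteq> 0"
    using lin_eq_0_imp[of c 0] n_gt_1 c by force
  define x where "x = lin c y"
  have "u * fr 1 x = (\<Sum>k<n. c (Suc k) * fr (Suc k) y)"
    by (simp add: x_def lin_def Suc sum_distrib_left fr_fr_add mult_ac del: fr_fr)
  \<comment> \<open>The cycle closes here: the terms at indices 0 and \<open>n\<close> both equal
    \<open>y\<close>.\<close>
  also have "\<dots> = (\<Sum>k<Suc n. c k * fr k y) - y"
    by (simp add: sum.lessThan_Suc_shift c(1) del: sum.lessThan_Suc)
  also have "\<dots> = x"
    by (simp add: x_def lin_def c)
  finally have "u * (x * x ^ (q - 1)) = x"
    using q_gt_1 by (simp add: fr_def flip: power_Suc)
  then have "u = (1 / x) ^ (q - 1)"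
    using y by (simp add: x_def field_simps power_divide)
  then show ?thesis
    using y by (intro exI[of _ "1 / x"]) (simp add: x_def)
qed

definition equiv_coeffs :: "(nat \<Rightarrow> 'a) \<Rightarrow> (nat \<Rightarrow> 'a) \<Rightarrow> bool" where
  "equiv_coeffs a b \<longleftrightarrow> (\<exists>l. l \<noteq> 0 \<and> (\<forall>x. lin b x = lin a (l * x) / l))"

text \<open>Rescaling by \<open>l\<close> multiplies coefficient \<open>k\<close> by
  \<open>l ^ (q ^ k - 1)\<close>, the product of the first \<open>k\<close> conjugates of
  \<open>u = l ^ (q - 1)\<close>.\<close>

lemma equiv_coeffsI:
  assumes "norm_F u = 1" and b: "\<And>k. k < n \<Longrightarrow> b k = a k * (\<Prod>j<k. fr j u)"
  shows "equiv_coeffs a b"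
proof -
  obtain l where l: "l \<noteq> 0" "u = l ^ (q - 1)"
    using hilbert90[OF assms(1)] by blast
  have *: "(\<Prod>j<k. fr j u) * l = fr k l" for k
  proof (induction k)
    case (Suc k)
    have "u * l = fr 1 l"
      using q_gt_1 by (simp add: l fr_def mult.commute flip: power_Suc)
    then have "fr k u * fr k l = fr (Suc k) l"
      by (metis add.right_neutral add_Suc_right fr_fr_add fr_mult One_nat_def)
    moreover have "(\<Prod>j<Suc k. fr j u) * l = fr k u * ((\<Prod>j<k. fr j u) * l)"
      by (simp add: mult_ac)
    ultimately show ?case
      by (simp only: Suc.IH)
  qed simp
  have "lin b x = lin a (l * x) / l" for x
  proof -
    have "lin b x * l = (\<Sum>k<n. a k * ((\<Prod>j<k. fr j u) * l) * fr k x)"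
      by (simp add: lin_def b sum_distrib_left sum_distrib_right mult_ac)
    also have "\<dots> = lin a (l * x)"
      by (simp add: lin_def *[symmetric] mult_ac)
    finally show ?thesis
      using l by (simp add: field_simps)
  qed
  then show ?thesis
    using l(1) by (auto simp: equiv_coeffs_def)
qed

text \<open>Brings the matrix into the shape of \<open>coeffs_det_2\<close> to
  \<open>coeffs_det_4\<close>, with \<open>m\<close> to be a numeral.\<close>

lemma dickson_poly_altdef:
  assumes "n = m" "a 0 = 0"
  shows "dickson_poly a = det (mat m m (\<lambda>(i, j).
    if i = j then monom 1 (q ^ i) else - [:fr i (a ((m + j - i) mod m)):]))"
  unfolding dickson_poly_def unfolding assms(1)
  by (rule arg_cong[where f = det], rule eq_matI) (use assms in auto)

section \<open>Invariants in dimension at most four\<close>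

lemma power_q_superincreasing:
  "0 < q ^ 0" "q ^ 0 < q ^ 1" "q ^ 0 + q ^ 1 < q ^ 2" "q ^ 0 + q ^ 1 + q ^ 2 < q ^ 3"
proof -
  have *: "2 * q ^ k \<le> q ^ Suc k" for k
    using q_gt_1 by simp
  show "0 < q ^ 0" "q ^ 0 < q ^ 1" "q ^ 0 + q ^ 1 < q ^ 2" "q ^ 0 + q ^ 1 + q ^ 2 < q ^ 3"
    using q_gt_1 *[of 1] *[of 2] by (simp_all add: numeral_eq_Suc)
qed

lemma norm_F_mult [simp]: "norm_F (x * y) = norm_F x * norm_F y"
  and norm_F_divide [simp]: "norm_F (x / y) = norm_F x / norm_F y"
  and norm_F_0 [simp]: "norm_F 0 = 0"
  and norm_F_eq_0_iff [simp]: "norm_F x = 0 \<longleftrightarrow> x = 0"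
  using n_gt_1 by (auto simp: norm_F_def prod.distrib prod_dividef)

lemma norm_F_fr [simp]: "norm_F (fr k x) = norm_F x"
proof (induction k)
  case (Suc k)
  have "norm_F (fr 1 y) = norm_F y" for y
  proof (cases "y = 0")
    case False
    have "y * norm_F (fr 1 y) = (\<Prod>i<Suc n. fr i y)"
      by (simp add: norm_F_def prod.lessThan_Suc_shift fr_fr_add del: fr_fr prod.lessThan_Suc)
    also have "\<dots> = y * norm_F y"
      by (simp add: norm_F_def)
    finally show ?thesis
      using False by simp
  qed simp
  from this[of "fr k x"] Suc show ?case
    by (simp add: fr_fr_add del: fr_fr)
qed simp

text \<open>The coefficients of the adjoint, indexed by the resulting exponent
  \<open>q ^ k\<close>.\<close>

definition hat :: "(nat \<Rightarrow> 'a) \<Rightarrow> nat \<Rightarrow> 'a" where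
  "hat a k = fr k (a ((n - k) mod n))"

lemma norm_F_small:
  "n = 2 \<Longrightarrow> norm_F x = x * fr 1 x"
  "n = 3 \<Longrightarrow> norm_F x = x * fr 1 x * fr 2 x"
  "n = 4 \<Longrightarrow> norm_F x = x * fr 1 x * fr 2 x * fr 3 x"
  by (unfold norm_F_def) (simp_all add: lessThan_nat_numeral mult_ac)

lemma invariants_2:
  assumes n: "n = 2" and "dickson_poly a = dickson_poly b" "a 0 = 0" "b 0 = 0"
  shows "norm_F (a 1) = norm_F (b 1)"
proof -
  have "norm_F (c 1) = - coeff (dickson_poly c) 0" if "c 0 = 0" for c
    unfolding dickson_poly_altdef[OF n, of c, OF that]
      coeffs_det_2[of "\<lambda>i. q ^ i", OF power_q_superincreasing(1,2)]
      norm_F_small(1)[OF n]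
    by (simp add: n)
  with assms show ?thesis
    by metis
qed

text \<open>The first invariant is a principal 2 by 2 minor. In the constant coefficient the two
  3-cycles contribute the two norms.\<close>

lemma invariants_3:
  assumes n: "n = 3" and "dickson_poly a = dickson_poly b" "a 0 = 0" "b 0 = 0"
  shows "a 1 * fr 1 (a 2) = b 1 * fr 1 (b 2)"
    and "norm_F (a 1) + norm_F (a 2) = norm_F (b 1) + norm_F (b 2)"
proof -
  note coeffs = coeffs_det_3[of "\<lambda>i. q ^ i", OF power_q_superincreasing(1,2,3)]
  have "c 1 * fr 1 (c 2) = - coeff (dickson_poly c) (q ^ 2)"
    and "norm_F (c 1) + norm_F (c 2) = - coeff (dickson_poly c) 0" if "c 0 = 0" for c
    unfolding dickson_poly_altdef[OF n, of c, OF that] coeffs norm_F_small(2)[OF n]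
    by (simp_all add: n mult_ac)
  with assms show "a 1 * fr 1 (a 2) = b 1 * fr 1 (b 2)"
    and "norm_F (a 1) + norm_F (a 2) = norm_F (b 1) + norm_F (b 2)"
    by metis+
qed

text \<open>The first three entries are negated coefficients of the Dickson polynomial. The last
  collects the six 4-cycles of the constant coefficient; the double transpositions are left out,
  being products of conjugates of the first two entries.\<close>

definition invariants_4 :: "(nat \<Rightarrow> 'a) \<Rightarrow> 'a list" where
  "invariants_4 a =
    [a 1 * fr 1 (a 3),
     a 2 * fr 2 (a 2),
     a 1 * fr 1 (a 1) * fr 2 (a 2) + a 2 * fr 1 (a 3) * fr 2 (a 3),
     norm_F (a 1) + norm_F (a 3)
     + (a 1 * fr 1 (a 2) * fr 2 (a 2) * fr 3 (a 3) + a 2 * fr 1 (a 3) * fr 2 (a 1) * fr 3 (a 2)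
      + a 2 * fr 1 (a 2) * fr 2 (a 3) * fr 3 (a 1) + a 3 * fr 1 (a 1) * fr 2 (a 2) * fr 3 (a 2))]"

lemma invariants_4_eqI:
  assumes n: "n = 4" and "dickson_poly a = dickson_poly b" "a 0 = 0" "b 0 = 0"
  shows "invariants_4 a = invariants_4 b"
proof -
  note coeffs = coeffs_det_4[of "\<lambda>i. q ^ i" "\<lambda>i j. fr i (c ((4 + j - i) mod 4))" for c, OF power_q_superincreasing]
  define D where "D c = det (mat 4 4 (\<lambda>(i, j). if i = j then monom 1 (q ^ i) else - [:fr i (c ((4 + j - i) mod 4)):]))" for c
  have D: "D a = D b"
    using assms(2)
    unfolding dickson_poly_altdef[OF n, of a, OF assms(3)] dickson_poly_altdef[OF n, of b, OF assms(4)] D_def .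
  have 1: "c 1 * fr 1 (c 3) = - coeff (D c) (q ^ 2 + q ^ 3)" for c
    unfolding D_def coeffs by (simp add: n)
  have 2: "c 2 * fr 2 (c 2) = - coeff (D c) (q ^ 1 + q ^ 3)" for c
    unfolding D_def coeffs by (simp add: n)
  have 3: "c 1 * fr 1 (c 1) * fr 2 (c 2) + c 2 * fr 1 (c 3) * fr 2 (c 3) = - coeff (D c) (q ^ 3)" for c
    unfolding D_def coeffs by (simp add: n)
  have 4: "norm_F (c 1) + norm_F (c 3)
     + (c 1 * fr 1 (c 2) * fr 2 (c 2) * fr 3 (c 3) + c 2 * fr 1 (c 3) * fr 2 (c 1) * fr 3 (c 2)
      + c 2 * fr 1 (c 2) * fr 2 (c 3) * fr 3 (c 1) + c 3 * fr 1 (c 1) * fr 2 (c 2) * fr 3 (c 2))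
    = - coeff (D c) 0 + (c 1 * fr 1 (c 3)) * fr 2 (c 1 * fr 1 (c 3))
      + (c 2 * fr 2 (c 2)) * fr 1 (c 2 * fr 2 (c 2))
      + fr 3 (c 1 * fr 1 (c 3)) * fr 1 (c 1 * fr 1 (c 3))" for c
    unfolding D_def coeffs norm_F_small(3)[OF n]
    by (simp add: n, simp add: numeral_2_eq_2 numeral_3_eq_3 algebra_simps)
  show ?thesis
    unfolding invariants_4_def 4 by (simp only: 1 2 3 D)
qed

text \<open>Conceptually, passing to the adjoint transposes the Dickson matrix; here the four
  entries are compared directly.\<close>

lemma invariants_4_hat:
  assumes "n = 4"
  shows "invariants_4 (hat a) = invariants_4 a"
  unfolding invariants_4_def hat_def norm_F_small(3)[OF assms]
  by (simp add: assms, simp add: numeral_2_eq_2 numeral_3_eq_3 algebra_simps)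

section \<open>Recovering coefficients from the invariants, up to scaling and adjoint\<close>

lemma lin_hat_hat: "lin (hat (hat a)) = lin a"
proof -
  have "hat (hat a) k = a k" if "k < n" for k
  proof (cases "k = 0")
    case False
    with that have "(n - k) mod n = n - k" "(n - (n - k)) mod n = k"
      by auto
    then show ?thesis
      using that by (simp add: hat_def)
  qed (simp add: hat_def)
  then show ?thesis
    by (auto simp: lin_def fun_eq_iff intro!: sum.cong)
qed

lemma equiv_coeffs_hat_hat: "equiv_coeffs (hat (hat a)) b \<longleftrightarrow> equiv_coeffs a b"
  by (simp add: equiv_coeffs_def lin_hat_hat)

lemma hat_3:
  assumes "n = 3"
  shows "hat a 0 = a 0" "hat a 1 = fr 1 (a 2)" "hat a 2 = fr 2 (a 1)"
  unfolding hat_def by (simp_all add: assms)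

lemma hat_4:
  assumes "n = 4"
  shows "hat a 0 = a 0" "hat a 1 = fr 1 (a 3)" "hat a 2 = fr 2 (a 2)" "hat a 3 = fr 3 (a 1)"
  unfolding hat_def by (simp_all add: assms)

text \<open>The last coefficient is given in the form \<open>ex_multiplier\<close> delivers; norm 1
  turns \<open>b2\<close> into \<open>b 2 = a 2 * (u * fr 1 u)\<close>.\<close>

lemma equiv_coeffs_3I:
  assumes n: "n = 3" and u: "norm_F u = 1" and "b 0 = a 0" "b 1 = a 1 * u"
    and b2: "fr 1 (a 2) = u * fr 1 (b 2)"
  shows "equiv_coeffs a b"
proof (rule equiv_coeffsI[OF u])
  have 1: "u * (fr 1 u * fr 2 u) = 1"
    using u unfolding norm_F_small(2)[OF n] by (simp add: mult_ac)
  have "fr 1 (a 2 * (u * fr 1 u)) = fr 1 (a 2) * (fr 1 u * fr 2 u)"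
    by (simp add: n, simp add: numeral_2_eq_2 numeral_3_eq_3)
  also have "\<dots> = fr 1 (b 2) * (u * (fr 1 u * fr 2 u))"
    by (simp only: b2 mult_ac)
  finally have "b 2 = a 2 * (u * fr 1 u)"
    unfolding 1 mult_1_right fr_eq_iff by (rule sym)
  moreover have "k = 0 \<or> k = 1 \<or> k = 2" if "k < n" for k
    using that n by auto
  ultimately show "b k = a k * (\<Prod>j<k. fr j u)" if "k < n" for k
    using that assms(3,4) by (force simp: lessThan_nat_numeral mult_ac)
qed

lemma equiv_coeffs_4I:
  assumes n: "n = 4" and u: "norm_F u = 1" and "b 0 = a 0" "b 1 = a 1 * u"
    and "b 2 = a 2 * (u * fr 1 u)" and b3: "fr 1 (a 3) = u * fr 1 (b 3)"
  shows "equiv_coeffs a b"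
proof (rule equiv_coeffsI[OF u])
  have 1: "u * (fr 1 u * fr 2 u * fr 3 u) = 1"
    using u unfolding norm_F_small(3)[OF n] by (simp add: mult_ac)
  have "fr 1 (a 3 * (u * fr 1 u * fr 2 u)) = fr 1 (a 3) * (fr 1 u * fr 2 u * fr 3 u)"
    by (simp add: n, simp add: numeral_2_eq_2 numeral_3_eq_3)
  also have "\<dots> = fr 1 (b 3) * (u * (fr 1 u * fr 2 u * fr 3 u))"
    by (simp only: b3 mult_ac)
  finally have "b 3 = a 3 * (u * fr 1 u * fr 2 u)"
    unfolding 1 mult_1_right fr_eq_iff by (rule sym)
  moreover have "k = 0 \<or> k = 1 \<or> k = 2 \<or> k = 3" if "k < n" for k
    using that n by auto
  ultimately show "b k = a k * (\<Prod>j<k. fr j u)" if "k < n" for k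
    using that assms(3,4,5) by (force simp: lessThan_nat_numeral mult_ac)
qed

text \<open>Whichever coefficient is nonzero on both sides defines \<open>u\<close> as a ratio; the
  product equation then gives the other relation.\<close>

lemma ex_multiplier:
  assumes "a1 * fr 1 am = b1 * fr 1 bm" "a1 \<noteq> 0 \<and> b1 \<noteq> 0 \<or> am \<noteq> 0 \<and> bm \<noteq> 0"
  shows "\<exists>u. u \<noteq> 0 \<and> b1 = a1 * u \<and> fr 1 am = u * fr 1 bm"
  using assms(2)
proof
  assume "a1 \<noteq> 0 \<and> b1 \<noteq> 0"
  with assms(1) show ?thesis
    by (intro exI[of _ "b1 / a1"]) (auto simp: field_simps)
next
  assume "am \<noteq> 0 \<and> bm \<noteq> 0"
  with assms(1) show ?thesis
    by (intro exI[of _ "fr 1 (am / bm)"]) (auto simp: field_simps)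
qed

text \<open>Passing from \<open>a\<close> to \<open>b\<close> multiplies one norm by
  \<open>norm_F u\<close> and divides the other by it, so \<open>add_eq_mult_add_divide\<close>
  applies. The norm inequality in the adjoint case is what later permits the canonical form
  \<open>x ^ q\<close>.\<close>

lemma equiv_coeffs_3_aux:
  assumes n: "n = 3" and a0: "b 0 = a 0" and prods: "a 1 * fr 1 (a 2) = b 1 * fr 1 (b 2)"
    and norms: "norm_F (a 1) + norm_F (a 2) = norm_F (b 1) + norm_F (b 2)"
    and u: "u \<noteq> 0" "b 1 = a 1 * u" "fr 1 (a 2) = u * fr 1 (b 2)"
    and nz: "a 1 \<noteq> 0 \<or> a 2 \<noteq> 0"
  shows "equiv_coeffs a b \<or> (norm_F (a 1) \<noteq> norm_F (a 2) \<and> equiv_coeffs (hat a) b)"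
proof -
  have "norm_F (fr 1 (a 2)) = norm_F u * norm_F (fr 1 (b 2))"
    by (simp only: u(3) norm_F_mult)
  then have "norm_F (b 2) = norm_F (a 2) / norm_F u"
    using u(1) by (simp add: field_simps)
  then have "norm_F (a 1) + norm_F (a 2) = norm_F (a 1) * norm_F u + norm_F (a 2) / norm_F u"
    using norms by (simp add: u(2)[simplified])
  then have "norm_F u = 1 \<or> norm_F (a 1) * norm_F u = norm_F (a 2)"
    using u(1) by (intro add_eq_mult_add_divide) auto
  \<comment> \<open>The second case excludes \<open>norm_F u = 1\<close>, which yields the
    inequality of norms.\<close>
  then consider "norm_F u = 1" | "norm_F u \<noteq> 1" "norm_F (a 1) * norm_F u = norm_F (a 2)"
    by blast
  then show ?thesis
  proof cases
    case 1
    then show ?thesis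
      using equiv_coeffs_3I[OF n 1 a0 u(2,3)] by blast
  next
    case 2
    then have nz': "a 1 \<noteq> 0" "a 2 \<noteq> 0"
      using nz u(1) by (metis mult_eq_0_iff norm_F_eq_0_iff)+
    \<comment> \<open>Since \<open>hat a 1 = fr 1 (a 2)\<close>, this is the multiplier from
      \<open>hat a\<close> to \<open>b\<close>.\<close>
    define w where "w = b 1 / fr 1 (a 2)"
    have "equiv_coeffs (hat a) b"
    proof (rule equiv_coeffs_3I[OF n])
      show "norm_F w = 1"
        using 2 nz' u(1) by (simp add: w_def u(2)[simplified])
      show "fr 1 (hat a 2) = w * fr 1 (b 2)"
        using nz' prods by (simp add: hat_3[OF n, simplified] w_def field_simps)
          (simp add: n mult.commute)
    qed (use nz' a0 in \<open>simp_all add: hat_3[OF n, simplified] w_def\<close>)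
    moreover have "norm_F (a 1) \<noteq> norm_F (a 2)"
      using 2 nz' by auto
    ultimately show ?thesis
      by blast
  qed
qed

lemma equiv_coeffs_3:
  assumes n: "n = 3" and a0: "b 0 = a 0" and prods: "a 1 * fr 1 (a 2) = b 1 * fr 1 (b 2)"
    and norms: "norm_F (a 1) + norm_F (a 2) = norm_F (b 1) + norm_F (b 2)"
    and nz: "a 1 \<noteq> 0 \<or> a 2 \<noteq> 0" "b 1 \<noteq> 0 \<or> b 2 \<noteq> 0"
  shows "equiv_coeffs a b \<or> (norm_F (a 1) \<noteq> norm_F (a 2) \<and> equiv_coeffs (hat a) b)"
proof (cases "a 1 \<noteq> 0 \<and> b 1 \<noteq> 0 \<or> a 2 \<noteq> 0 \<and> b 2 \<noteq> 0")
  case True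
  then show ?thesis
    using ex_multiplier[OF prods] equiv_coeffs_3_aux[OF n a0 prods norms _ _ _ nz(1)] by blast
next
  case False
  \<comment> \<open>Now \<open>a\<close> and \<open>b\<close> are each supported on one of the
    indices 1 and 2, and on different ones; \<open>hat\<close> swaps these indices. One norm of
    \<open>a\<close> is therefore zero and the other is not.\<close>
  have prods': "hat a 1 * fr 1 (hat a 2) = b 1 * fr 1 (b 2)"
    using prods unfolding hat_3[OF n] by (simp add: n mult.commute)
  have norms': "norm_F (hat a 1) + norm_F (hat a 2) = norm_F (b 1) + norm_F (b 2)"
    using norms unfolding hat_3[OF n] by (simp add: add.commute)
  have "hat a 1 \<noteq> 0 \<and> b 1 \<noteq> 0 \<or> hat a 2 \<noteq> 0 \<and> b 2 \<noteq> 0"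
    using False nz unfolding hat_3[OF n] by auto
  then have "equiv_coeffs (hat a) b \<or> equiv_coeffs (hat (hat a)) b"
    using ex_multiplier[OF prods'] equiv_coeffs_3_aux[of b "hat a", OF n _ prods' norms'] a0
    by (metis hat_3(1)[OF n] mult_zero_left fr_eq_0_iff)
  moreover have "norm_F (a 1) \<noteq> norm_F (a 2)"
    using False nz by (metis norm_F_eq_0_iff)
  ultimately show ?thesis
    by (auto simp: equiv_coeffs_hat_hat)
qed

text \<open>If \<open>a 2\<close> vanishes, the norms decide as in dimension 3. Otherwise the third
  invariant decides, and the second one supplies the required norm 1.\<close>

lemma equiv_coeffs_4_aux:
  assumes n: "n = 4" and a0: "b 0 = a 0" and inv: "invariants_4 a = invariants_4 b"
    and u: "u \<noteq> 0" "b 1 = a 1 * u" "fr 1 (a 3) = u * fr 1 (b 3)"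
    and nz: "a 1 \<noteq> 0 \<or> a 3 \<noteq> 0"
  shows "equiv_coeffs a b \<or> equiv_coeffs (hat a) b"
proof -
  have prods: "a 1 * fr 1 (a 3) = b 1 * fr 1 (b 3)"
    and I2: "a 2 * fr 2 (a 2) = b 2 * fr 2 (b 2)"
    and I3: "a 1 * fr 1 (a 1) * fr 2 (a 2) + a 2 * fr 1 (a 3) * fr 2 (a 3)
      = b 1 * fr 1 (b 1) * fr 2 (b 2) + b 2 * fr 1 (b 3) * fr 2 (b 3)"
    using inv by (auto simp: invariants_4_def)
  define w where "w = b 1 / fr 1 (a 3)"
  have hatI: "equiv_coeffs (hat a) b"
    if "norm_F w = 1" "b 2 = fr 2 (a 2) * (w * fr 1 w)" "a 3 \<noteq> 0"
  proof (rule equiv_coeffs_4I[OF n that(1)])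
    show "fr 1 (hat a 3) = w * fr 1 (b 3)"
      using that(3) prods by (simp add: hat_4[OF n, simplified] w_def field_simps)
        (simp add: n mult.commute)
  qed (use that a0 in \<open>simp_all add: hat_4[OF n, simplified] w_def\<close>)
  show ?thesis
  proof (cases "a 2 = 0")
    case True
    then have b2: "b 2 = 0"
      using I2 by auto
    have "norm_F (fr 1 (a 3)) = norm_F u * norm_F (fr 1 (b 3))"
      by (simp only: u(3) norm_F_mult)
    then have "norm_F (b 3) = norm_F (a 3) / norm_F u"
      using u(1) by (simp add: field_simps)
    moreover have "norm_F (a 1) + norm_F (a 3) = norm_F (b 1) + norm_F (b 3)"
      using inv True b2 by (simp add: invariants_4_def)
    ultimately have "norm_F (a 1) + norm_F (a 3) = norm_F (a 1) * norm_F u + norm_F (a 3) / norm_F u"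
      by (simp add: u(2)[simplified])
    then have "norm_F u = 1 \<or> norm_F (a 1) * norm_F u = norm_F (a 3)"
      using u(1) by (intro add_eq_mult_add_divide) auto
    then show ?thesis
    proof
      assume "norm_F u = 1"
      then have "equiv_coeffs a b"
        using equiv_coeffs_4I[OF n _ a0 u(2) _ u(3)] True b2 by simp
      then show ?thesis ..
    next
      assume 2: "norm_F (a 1) * norm_F u = norm_F (a 3)"
      then have nz': "a 1 \<noteq> 0" "a 3 \<noteq> 0"
        using nz u(1) by (metis mult_eq_0_iff norm_F_eq_0_iff)+
      have "norm_F w = 1"
        using 2 nz' u(1) by (simp add: w_def u(2)[simplified])
      then show ?thesis
        using hatI nz' True b2 by simp
    qed
  next
    case False
    then have b2: "b 2 \<noteq> 0"
      using I2 by auto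
    \<comment> \<open>By the second invariant \<open>v * fr 2 v = 1\<close>, so \<open>v\<close> has
      norm 1 over the fixed field of \<open>fr 2\<close>.\<close>
    define v where "v = b 2 / a 2"
    have v: "b 2 = a 2 * v" "v \<noteq> 0" "v * fr 2 v = 1"
      using False b2 I2 by (auto simp: v_def field_simps)
    then have fr2v: "fr 2 v = 1 / v"
      by (simp add: field_simps)
    have fr1b3: "fr 1 (b 3) = fr 1 (a 3) / u"
      using u by (simp add: field_simps)
    have fr2b3: "fr 2 (b 3) = fr 2 (a 3) / fr 1 u"
    proof -
      have "fr 1 (fr 1 (b 3)) = fr 1 (fr 1 (a 3)) / fr 1 u"
        unfolding fr1b3 by (simp only: fr_divide)
      then show ?thesis
        by (simp add: n numeral_2_eq_2)
    qed
    \<comment> \<open>\<open>z = 1\<close> is the relation between \<open>b 2\<close> and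
      \<open>a 2\<close> that \<open>equiv_coeffs_4I\<close> needs; the two summands of the third
      invariant scale by \<open>z\<close> and \<open>1 / z\<close>.\<close>
    define z where "z = u * fr 1 u / v"
    have "b 1 * fr 1 (b 1) * fr 2 (b 2) = (a 1 * fr 1 (a 1) * fr 2 (a 2)) * z"
      by (simp add: u(2)[simplified] v(1) fr2v z_def)
    moreover have "b 2 * fr 1 (b 3) * fr 2 (b 3) = (a 2 * fr 1 (a 3) * fr 2 (a 3)) / z"
      unfolding fr1b3 fr2b3 by (simp add: v(1) z_def)
    moreover have "z \<noteq> 0"
      using u v by (simp add: z_def)
    ultimately have "z = 1 \<or> a 1 * fr 1 (a 1) * fr 2 (a 2) * z = a 2 * fr 1 (a 3) * fr 2 (a 3)"
      using I3 by (intro add_eq_mult_add_divide) auto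
    then show ?thesis
    proof
      assume "z = 1"
      then have vu: "v = u * fr 1 u"
        using v by (simp add: z_def field_simps)
      have "norm_F u = v * fr 2 v"
        unfolding norm_F_small(3)[OF n] vu by (simp add: n)
      then have "equiv_coeffs a b"
        using equiv_coeffs_4I[OF n _ a0 u(2) _ u(3)] v vu by simp
      then show ?thesis ..
    next
      assume 2: "a 1 * fr 1 (a 1) * fr 2 (a 2) * z = a 2 * fr 1 (a 3) * fr 2 (a 3)"
      then have nz': "a 1 \<noteq> 0" "a 3 \<noteq> 0"
        using nz False \<open>z \<noteq> 0\<close> by auto
      \<comment> \<open>The other root is rearranged into the same relation for
        \<open>hat a\<close>, whose coefficient 2 is \<open>fr 2 (a 2)\<close>.\<close>
      have "b 1 * fr 1 (b 1) * fr 2 (a 2) = b 2 * (fr 1 (a 3) * fr 2 (a 3))"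
        using 2 False v by (simp add: u(2)[simplified] z_def field_simps)
      then have "b 2 = fr 2 (a 2) * (b 1 / fr 1 (a 3) * (fr 1 (b 1) / fr 2 (a 3)))"
        using nz' by (simp add: field_simps)
      also have "fr 1 (b 1) / fr 2 (a 3) = fr 1 w"
        by (simp add: w_def n numeral_2_eq_2)
      finally have w: "b 2 = fr 2 (a 2) * (w * fr 1 w)"
        unfolding w_def .
      have "norm_F w = (w * fr 1 w) * fr 2 (w * fr 1 w)"
        unfolding norm_F_small(3)[OF n] by (simp add: n)
      also have "w * fr 1 w = b 2 / fr 2 (a 2)"
        using w False by simp
      also have "b 2 / fr 2 (a 2) * fr 2 (b 2 / fr 2 (a 2)) = 1"
        using I2 False b2 by (simp add: n mult.commute)
      finally show ?thesis
        using hatI w nz' by blast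
    qed
  qed
qed

lemma equiv_coeffs_4:
  assumes n: "n = 4" and a0: "b 0 = a 0" and inv: "invariants_4 a = invariants_4 b"
    and nz: "a 1 \<noteq> 0 \<or> a 3 \<noteq> 0" "b 1 \<noteq> 0 \<or> b 3 \<noteq> 0"
  shows "equiv_coeffs a b \<or> equiv_coeffs (hat a) b"
proof (cases "a 1 \<noteq> 0 \<and> b 1 \<noteq> 0 \<or> a 3 \<noteq> 0 \<and> b 3 \<noteq> 0")
  case True
  then show ?thesis
    using ex_multiplier[of "a 1" "a 3" "b 1" "b 3"] equiv_coeffs_4_aux[OF n a0 inv _ _ _ nz(1)] inv
    by (auto simp: invariants_4_def)
next
  case False
  \<comment> \<open>As in dimension 3, the supports within the indices 1 and 3 are disjoint, and
    \<open>hat\<close> swaps these indices.\<close>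
  have inv': "invariants_4 (hat a) = invariants_4 b"
    using inv invariants_4_hat[OF n] by simp
  then have prods': "hat a 1 * fr 1 (hat a 3) = b 1 * fr 1 (b 3)"
    by (simp add: invariants_4_def)
  have nz': "hat a 1 \<noteq> 0 \<and> b 1 \<noteq> 0 \<or> hat a 3 \<noteq> 0 \<and> b 3 \<noteq> 0"
    using False nz unfolding hat_4[OF n] by auto
  have "b 0 = hat a 0"
    by (simp add: hat_4[OF n] a0)
  then have "equiv_coeffs (hat a) b \<or> equiv_coeffs (hat (hat a)) b"
    using ex_multiplier[OF prods' nz'] equiv_coeffs_4_aux[of b "hat a", OF n _ inv'] nz'
    by metis
  then show ?thesis
    by (auto simp: equiv_coeffs_hat_hat)
qed

section \<open>From image sets and linearity fields to coefficients\<close>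

lemma lin_update_0: "lin (a(0 := 0)) x = lin a x - a 0 * x"
proof -
  have "{..<n} = insert 0 {1..<n}"
    using n_gt_1 by auto
  then show ?thesis
    by (simp add: lin_def)
qed

lemma lin_diff: "lin a (x - y) = lin a x - lin a y"
  by (simp add: lin_def algebra_simps sum_subtractf)

text \<open>Subleading coefficients identify \<open>a 0\<close> with \<open>b 0\<close>; translating
  both image sets by it then removes the linear term.\<close>

lemma image_eq_imp:
  assumes "{lin a x / x |x. x \<noteq> 0} = {lin b x / x |x. x \<noteq> 0}"
  shows "b 0 = a 0" and "dickson_poly (a(0 := 0)) = dickson_poly (b(0 := 0))"
proof -
  show 0: "b 0 = a 0"
    using dickson_poly_eqI[OF assms] coeff_dickson_poly_subleading[of a]
      coeff_dickson_poly_subleading[of b] by simp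
  have *: "{lin (c(0 := 0)) x / x |x. x \<noteq> 0} = (\<lambda>t. t - c 0) ` {lin c x / x |x. x \<noteq> 0}" for c
    by (force simp: lin_update_0 diff_divide_distrib image_iff)
  show "dickson_poly (a(0 := 0)) = dickson_poly (b(0 := 0))"
    by (rule dickson_poly_eqI) (simp only: * assms 0)
qed

text \<open>Counting roots bounds the fixed field from above. For the lower bound, the relative
  trace \<open>t\<close> maps into it with fibres of size at most
  \<open>q ^ (d * (m - 1))\<close>.\<close>

lemma card_fixed_field:
  assumes "n = d * m"
  shows "card {x :: 'a. fr d x = x} = q ^ d"
proof -
  let ?L = "{x. fr d x = x}"
  have d: "0 < d" and m: "0 < m"
    using assms n_gt_1 by (auto intro!: Nat.gr0I)
  have card_root: "card {x. poly p x = 0} \<le> N" if "coeff p N = 1" "degree p \<le> N" for p :: "'a poly" and N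
    using card_poly_roots_bound[of p] that by (cases "p = 0") auto
  define p :: "'a poly" where "p = monom 1 (q ^ d) - monom 1 1"
  have "1 < q ^ d"
    using q_gt_1 d by (rule one_less_power)
  then have "card {x. poly p x = 0} \<le> q ^ d"
    by (intro card_root) (auto simp: p_def intro!: degree_diff_le order.trans[OF degree_monom_le])
  then have le: "card ?L \<le> q ^ d"
    by (simp add: p_def poly_monom fr_def)
  define t where "t x = (\<Sum>i<m. fr (d * i) x)" for x
  have t_L: "t x \<in> ?L" for x
  proof -
    have "fr d (t x) + x = (\<Sum>i<Suc m. fr (d * i) x)"
      by (simp add: t_def sum.lessThan_Suc_shift fr_fr_add del: fr_fr sum.lessThan_Suc)
    also have "\<dots> = t x + x"
      by (simp add: t_def flip: assms)
    finally show ?thesis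
      by simp
  qed
  have fibre: "card {x. t x = y} \<le> q ^ (d * (m - 1))" for y
  proof -
    define r :: "'a poly" where "r = (\<Sum>i<m. monom 1 (q ^ (d * i))) - [:y:]"
    have "degree (\<Sum>i<m. monom (1 :: 'a) (q ^ (d * i))) \<le> q ^ (d * (m - 1))"
      using q_gt_1 d by (intro degree_sum_le order.trans[OF degree_monom_le] power_increasing) auto
    then have "degree r \<le> q ^ (d * (m - 1))"
      unfolding r_def by (intro degree_diff_le) auto
    moreover have "coeff r (q ^ (d * (m - 1))) = 1"
    proof -
      have "coeff r (q ^ (d * (m - 1))) = (\<Sum>i<m. if i = m - 1 then 1 else 0)"
        using q_gt_1 d by (auto simp: r_def coeff_sum coeff_pCons split: nat.splits intro!: sum.cong)
      then show ?thesis
        using m by simp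
    qed
    ultimately have "card {x. poly r x = 0} \<le> q ^ (d * (m - 1))"
      by (intro card_root)
    then show ?thesis
      by (simp add: r_def t_def poly_sum poly_monom fr_def)
  qed
  have "(UNIV :: 'a set) = (\<Union>y\<in>?L. {x. t x = y})"
    using t_L by auto
  then have "q ^ n \<le> (\<Sum>y\<in>?L. card {x. t x = y})"
    using card_UN_le[of ?L "\<lambda>y. {x. t x = y}"] by (simp flip: card_UNIV)
  also have "\<dots> \<le> card ?L * q ^ (d * (m - 1))"
    using sum_mono[of ?L "\<lambda>y. card {x. t x = y}" "\<lambda>y. q ^ (d * (m - 1))"] fibre by simp
  also have "q ^ n = q ^ d * q ^ (d * (m - 1))"
    using m by (cases m) (simp_all add: assms power_add)
  finally have "q ^ d \<le> card ?L"
    using q_gt_1 by simp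
  with le show ?thesis
    by simp
qed

text \<open>Otherwise \<open>f\<close> would be linear over the fixed field of \<open>fr d\<close>,
  whose \<open>q ^ d\<close> elements do not fit into \<open>Fq\<close>.\<close>

lemma ex_coeff_if_max_linearity_field:
  assumes max: "max_linearity_field q f Fq" "card Fq = q"
    and f: "\<And>x. poly f x = lin a x" and d: "n = d * m" "1 < d"
  shows "\<exists>k<n. \<not> d dvd k \<and> a k \<noteq> 0"
proof (rule ccontr)
  assume *: "\<not> (\<exists>k<n. \<not> d dvd k \<and> a k \<noteq> 0)"
  let ?L = "{x :: 'a. fr d x = x}"
  have "lin a (\<mu> * x) = \<mu> * lin a x" if "fr d \<mu> = \<mu>" for \<mu> x
  proof -
    have "fr (d * j) \<mu> = \<mu>" for j
      by (induction j) (simp_all add: that fr_fr_add[symmetric] del: fr_fr)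
    then have \<mu>: "a k * fr k \<mu> = a k * \<mu>" if "k < n" for k
      using * that by (auto elim!: dvdE)
    have "a k * fr k (\<mu> * x) = \<mu> * (a k * fr k x)" if "k < n" for k
    proof -
      have "a k * fr k (\<mu> * x) = (a k * fr k \<mu>) * fr k x"
        by (simp only: fr_mult mult.assoc)
      then show ?thesis
        unfolding \<mu>[OF that] by (simp only: mult_ac)
    qed
    then show ?thesis
      unfolding lin_def sum_distrib_left by (intro sum.cong refl) (simp only: lessThan_iff)
  qed
  then have "linearity_field q f ?L"
    using card_fixed_field[OF d(1)] by (auto simp: linearity_field_def is_subfield_def f)
  then have "?L \<subseteq> Fq"
    using max by (auto simp: max_linearity_field_def)
  then have "q ^ d \<le> q"
    using card_mono[of Fq ?L] max(2) card_fixed_field[OF d(1)] by simp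
  then show False
    using q_gt_1 d(2) power_strict_increasing[of 1 d q] by simp
qed

lemma poly_qpolyE:
  assumes "qpoly q n f"
  obtains a where "\<And>x. poly f x = lin a x" "\<And>x. poly (adjoint_qpoly q n f) x = lin (hat a) x"
proof -
  obtain a where a: "f = (\<Sum>i<n. monom (a i) (q ^ i))"
    using assms by (auto simp: qpoly_def)
  have coeff: "coeff f (q ^ k) = a k" if "k < n" for k
  proof -
    have "coeff f (q ^ k) = (\<Sum>i<n. if i = k then a i else 0)"
      unfolding a coeff_sum using q_gt_1 by (intro sum.cong) auto
    then show ?thesis
      using that by simp
  qed
  define g where "g x i = fr (n - i) (a i) * fr ((n - i) mod n) x" for x i
  have "poly (adjoint_qpoly q n f) x = lin (hat a) x" for x
  proof -
    have "poly (adjoint_qpoly q n f) x = (\<Sum>i<n. g x i)"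
      by (simp add: adjoint_qpoly_def poly_sum poly_monom coeff g_def fr_def)
    also have "\<dots> = (\<Sum>k<n. g x ((n + 0 - k) mod n))"
      using n_gt_1 by (intro sum_shift(2)[symmetric]) simp
    also have "\<dots> = lin (hat a) x"
      unfolding lin_def
    proof (rule sum.cong)
      fix k assume "k \<in> {..<n}"
      \<comment> \<open>At \<open>k = 0\<close> the unreduced index is \<open>n\<close>, not 0, so
        the comparison is made modulo \<open>n\<close>.\<close>
      then have "(n - (n - k) mod n) mod n = k"
        by (cases "k = 0") auto
      then have "fr (n - (n - k) mod n) y = fr k y" for y
        by (metis fr_mod)
      then show "g x ((n + 0 - k) mod n) = hat a k * fr k x"
        by (simp add: g_def hat_def fr_mod)
    qed simp
    finally show ?thesis .
  qed
  moreover have "poly f x = lin a x" for x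
    by (simp add: a lin_def poly_sum poly_monom fr_def)
  ultimately show ?thesis
    using that by blast
qed

section \<open>Canonical forms\<close>

lemma lin_small:
  "n = 2 \<Longrightarrow> lin a x = a 0 * x + a 1 * fr 1 x"
  "n = 3 \<Longrightarrow> lin a x = a 0 * x + a 1 * fr 1 x + a 2 * fr 2 x"
  by (unfold lin_def) (simp_all add: lessThan_nat_numeral add_ac)

text \<open>Solve \<open>poly f x = a 0 * x + a 1 * x ^ q\<close> for \<open>x ^ q\<close>.\<close>

lemma ex_transform_power_2:
  assumes n: "n = 2" and f: "\<And>x. poly f x = lin a x" and "a 1 \<noteq> 0"
  shows "\<exists>\<phi>. invertible \<phi> \<and> transforms_to \<phi> f (\<lambda>x. x ^ q)"
proof (rule ex_transforms_toI)
  show "- a 0 / a 1 * x + 1 / a 1 * poly f x = (1 * x + 0 * poly f x) ^ q" for x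
    using assms(3) by (simp add: f lin_small(1)[OF n] field_simps) (simp add: fr_def)
qed (use assms q_gt_1 lin_diff in auto)

lemma ex_transform_power_3:
  assumes n: "n = 3" and f: "\<And>x. poly f x = lin a x" and norm: "norm_F (a 1) \<noteq> norm_F (a 2)"
  shows "\<exists>\<phi>. invertible \<phi> \<and> transforms_to \<phi> f (\<lambda>x. x ^ q)"
proof -
  \<comment> \<open>The equations come from comparing coefficients when the second coordinate is
    required to be the Frobenius image of the first,
    \<open>A * x + b * (poly f x - a 0 * x)\<close>. The last condition is the determinant.\<close>
  have *: "\<exists>\<phi>. invertible \<phi> \<and> transforms_to \<phi> f (\<lambda>x. x ^ q)"
    if "d * a 1 = fr 1 A" "d * a 2 = fr 1 (b * a 1)" "A * d - b * fr 1 (b * a 2) \<noteq> 0" for A b d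
  proof (rule ex_transforms_toI)
    show "(fr 1 (b * a 2) - d * a 0) * x + d * poly f x = ((A - b * a 0) * x + b * poly f x) ^ q" for x
    proof -
      have "(fr 1 (b * a 2) - d * a 0) * x + d * poly f x
          = fr 1 (b * a 2) * x + (d * a 1) * fr 1 x + (d * a 2) * fr 2 x"
        by (simp add: f lin_small(2)[OF n] algebra_simps)
      also have "\<dots> = fr 1 (A * x + (b * a 1) * fr 1 x + (b * a 2) * fr 2 x)"
        unfolding that by (simp add: n, simp add: numeral_2_eq_2)
      also have "A * x + (b * a 1) * fr 1 x + (b * a 2) * fr 2 x = (A - b * a 0) * x + b * poly f x"
        by (simp add: f lin_small(2)[OF n] algebra_simps)
      finally show ?thesis
        by (simp only: fr_def power_one_right)
    qed
    show "(A - b * a 0) * d - b * (fr 1 (b * a 2) - d * a 0) \<noteq> 0"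
      using that(3) by (simp add: algebra_simps)
  qed (use q_gt_1 lin_diff f in auto)
  show ?thesis
  proof (cases "a 2 = 0")
    case True
    then have "a 1 \<noteq> 0"
      using norm by auto
    then show ?thesis
      using True by (intro *[of 1 "fr 2 (a 1)" 0]) (auto simp: n)
  next
    case False
    \<comment> \<open>With \<open>b = 1\<close> the equations force \<open>d\<close> and
      \<open>A\<close>; a conjugate of the determinant is a nonzero multiple of the difference of
      norms.\<close>
    define d where "d = fr 1 (a 1) / a 2"
    have "fr 1 (fr 2 (d * a 1) * d - fr 1 (a 2)) = (norm_F (a 1) - norm_F (a 2)) / (a 2 * fr 1 (a 2))"
      unfolding norm_F_small(2)[OF n] using False
      by (simp add: d_def n, simp add: numeral_2_eq_2 field_simps)
    then have "fr 1 (fr 2 (d * a 1) * d - fr 1 (a 2)) \<noteq> 0"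
      using norm False by simp
    then have "fr 2 (d * a 1) * d - fr 1 (a 2) \<noteq> 0"
      by (metis fr_0)
    then show ?thesis
      using False by (intro *[of d "fr 2 (d * a 1)" 1]) (auto simp: n d_def)
  qed
qed

text \<open>By Hilbert 90 the coefficients 1 and 2 are \<alpha> times \<open>l\<close> and
  \<open>fr 1 l\<close>, so \<open>poly f x - a 0 * x\<close> equals \<alpha> times the trace of
  \<open>\<beta> * x\<close> without its first term.\<close>

lemma ex_transform_Tr_3:
  assumes n: "n = 3" and f: "\<And>x. poly f x = lin a x" and norm: "norm_F (a 1) = norm_F (a 2)"
    and "a 1 \<noteq> 0"
  shows "\<exists>\<phi>. invertible \<phi> \<and> transforms_to \<phi> f (Tr q n)"
proof -
  have "norm_F (a 2 / a 1) = 1"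
    using \<open>a 1 \<noteq> 0\<close> by (simp add: norm[symmetric, simplified])
  then obtain l where l: "l \<noteq> 0" "a 2 / a 1 = l ^ (q - 1)"
    using hilbert90 by blast
  have "l * l ^ (q - 1) = fr 1 l"
    using q_gt_1 by (simp add: fr_def flip: power_Suc)
  moreover have "a 2 = a 1 * l ^ (q - 1)"
    using l(2) \<open>a 1 \<noteq> 0\<close> by (simp add: field_simps)
  ultimately have a2: "a 2 * l = a 1 * fr 1 l"
    by (metis mult.assoc mult.commute)
  \<comment> \<open>\<beta> is chosen to have conjugates \<open>l\<close> and
    \<open>fr 1 l\<close>.\<close>
  define \<alpha> \<beta> where "\<alpha> = a 1 / l" and "\<beta> = fr 2 l"
  have \<alpha>: "\<alpha> \<noteq> 0" and \<beta>: "\<beta> \<noteq> 0" and a1: "a 1 = \<alpha> * l" and a2: "a 2 = \<alpha> * fr 1 l"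
    using \<open>a 1 \<noteq> 0\<close> l a2 by (auto simp: \<alpha>_def \<beta>_def field_simps)
  have Tr: "Tr q n x = x + fr 1 x + fr 2 x" for x
    by (simp add: Tr_def fr_def n lessThan_nat_numeral add_ac)
  show ?thesis
  proof (rule ex_transforms_toI)
    show "(\<beta> - a 0 / \<alpha>) * x + 1 / \<alpha> * poly f x = Tr q n (\<beta> * x + 0 * poly f x)" for x
    proof -
      have "fr 1 \<beta> = l" "fr 2 \<beta> = fr 1 l"
        by (simp_all add: \<beta>_def n)
      then have "Tr q n (\<beta> * x) = \<beta> * x + l * fr 1 x + fr 1 l * fr 2 x"
        unfolding Tr by simp
      moreover have "1 / \<alpha> * poly f x = a 0 / \<alpha> * x + l * fr 1 x + fr 1 l * fr 2 x"
        unfolding f lin_small(2)[OF n] a1 a2 using \<alpha> by (simp add: field_simps)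
      ultimately show ?thesis
        by (simp add: algebra_simps)
    qed
    show "Tr q n (0 :: 'a) = 0"
      unfolding Tr by simp
  qed (use \<alpha> \<beta> lin_diff f in auto)
qed

end

section \<open>The classification for \<open>n\<close> equal to 2, 3 and 4\<close>

theorem theorem2p6:
  fixes q n :: nat
    and f g :: "'a::{field,finite} poly"
    and Fq :: "'a set"
  assumes "primepow q"
    and "n \<in> {2, 3, 4}"
    and "CARD('a) = q ^ n"
    and "is_subfield Fq" and "card Fq = q"
    and "qpoly q n f" and "qpoly q n g"
    and "max_linearity_field q f Fq" and "max_linearity_field q g Fq"
    and "Im_quot f = Im_quot g"
  shows "\<exists>(\<phi> :: 'a ^ 2 ^ 2) (l :: 'a). invertible \<phi> \<and> l \<noteq> 0 \<and>
    (n = 2 \<longrightarrow>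
       transforms_to \<phi> f (\<lambda>x. x ^ q) \<and> (\<forall>x. poly g x = poly f (l * x) / l)) \<and>
    (n = 3 \<longrightarrow>
       (transforms_to \<phi> f (Tr q n) \<and> (\<forall>x. poly g x = poly f (l * x) / l)) \<or>
       (transforms_to \<phi> f (\<lambda>x. x ^ q) \<and>
         ((\<forall>x. poly g x = poly f (l * x) / l) \<or>
          (\<forall>x. poly g x = poly (adjoint_qpoly q n f) (l * x) / l)))) \<and>
    (n = 4 \<longrightarrow>
       (\<forall>x. poly g x = poly f (l * x) / l) \<or>
       (\<forall>x. poly g x = poly (adjoint_qpoly q n f) (l * x) / l))"
proof -
  interpret gf_extension q n "TYPE('a)"
    using assms(1-3) by unfold_locales auto
  obtain a where f: "\<And>x. poly f x = lin a x" "\<And>x. poly (adjoint_qpoly q n f) x = lin (hat a) x"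
    using poly_qpolyE[OF assms(6)] by blast
  obtain b where g: "\<And>x. poly g x = lin b x"
    using poly_qpolyE[OF assms(7)] by blast
  have Im: "{lin a x / x |x. x \<noteq> 0} = {lin b x / x |x. x \<noteq> 0}"
    using assms(10) by (simp add: Im_quot_def f g)
  note b0 = image_eq_imp(1)[OF Im] and D = image_eq_imp(2)[OF Im]
  note ex_a = ex_coeff_if_max_linearity_field[OF assms(8,5) f(1)]
  note ex_b = ex_coeff_if_max_linearity_field[OF assms(9,5) g]
  have equiv: "\<exists>l. l \<noteq> 0 \<and> (\<forall>x. poly g x = poly f (l * x) / l)" if "equiv_coeffs a b"
    using that by (simp add: equiv_coeffs_def f g)
  have equiv_hat: "\<exists>l. l \<noteq> 0 \<and> (\<forall>x. poly g x = poly (adjoint_qpoly q n f) (l * x) / l)"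
    if "equiv_coeffs (hat a) b"
    using that by (simp add: equiv_coeffs_def f g)
  consider "n = 2" | "n = 3" | "n = 4"
    using assms(2) by blast
  then show ?thesis
  proof cases
    case 1
    have a1: "a 1 \<noteq> 0"
      using ex_a[of 2 1] 1 by (auto simp: less_2_cases_iff)
    have "norm_F (b 1) = norm_F (a 1)"
      using invariants_2[OF 1 D] by simp
    then have "norm_F (b 1 / a 1) = 1"
      using a1 by simp
    then have "equiv_coeffs a b"
      using a1 b0 1 by (intro equiv_coeffsI[of "b 1 / a 1"]) (auto simp: less_2_cases_iff)
    then show ?thesis
      using equiv ex_transform_power_2[OF 1 f(1) a1] 1 by auto
  next
    case 2
    have less_3: "k < 3 \<and> \<not> 3 dvd k \<longleftrightarrow> k = 1 \<or> k = 2" for k :: nat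
      by presburger
    have ex_a': "\<exists>k. (k < 3 \<and> \<not> 3 dvd k) \<and> a k \<noteq> 0"
      and ex_b': "\<exists>k. (k < 3 \<and> \<not> 3 dvd k) \<and> b k \<noteq> 0"
      using ex_a[of 3 1] ex_b[of 3 1] unfolding 2 by (simp_all add: conj_assoc)
    have nz: "a 1 \<noteq> 0 \<or> a 2 \<noteq> 0" "b 1 \<noteq> 0 \<or> b 2 \<noteq> 0"
      using ex_a'[unfolded less_3] ex_b'[unfolded less_3] by auto
    have "equiv_coeffs a b \<or> (norm_F (a 1) \<noteq> norm_F (a 2) \<and> equiv_coeffs (hat a) b)"
      using invariants_3[OF 2 D] b0 nz by (intro equiv_coeffs_3[OF 2]) auto
    moreover have "\<exists>\<phi>. invertible \<phi> \<and> transforms_to \<phi> f (\<lambda>x. x ^ q)" if "norm_F (a 1) \<noteq> norm_F (a 2)"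
      using ex_transform_power_3[OF 2 f(1) that] .
    \<comment> \<open>Equal norms vanish together, so \<open>a 1\<close> is nonzero here; equality
      also rules out the adjoint alternative.\<close>
    moreover have "\<exists>\<phi>. invertible \<phi> \<and> transforms_to \<phi> f (Tr q n)" if "norm_F (a 1) = norm_F (a 2)"
      using ex_transform_Tr_3[OF 2 f(1) that] nz(1) that by (metis norm_F_eq_0_iff)
    ultimately show ?thesis
      using equiv equiv_hat 2 by (cases "norm_F (a 1) = norm_F (a 2)") fastforce+
  next
    case 3
    \<comment> \<open>Taking \<open>d = 2\<close> excludes linearity over the intermediate field of
      order \<open>q ^ 2\<close>, leaving a nonzero coefficient at an odd index.\<close>
    have less_4: "k < 4 \<and> \<not> 2 dvd k \<longleftrightarrow> k = 1 \<or> k = 3" for k :: nat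
      by presburger
    have ex_a': "\<exists>k. (k < 4 \<and> \<not> 2 dvd k) \<and> a k \<noteq> 0"
      and ex_b': "\<exists>k. (k < 4 \<and> \<not> 2 dvd k) \<and> b k \<noteq> 0"
      using ex_a[of 2 2] ex_b[of 2 2] unfolding 3 by (simp_all add: conj_assoc)
    have nz: "a 1 \<noteq> 0 \<or> a 3 \<noteq> 0" "b 1 \<noteq> 0 \<or> b 3 \<noteq> 0"
      using ex_a'[unfolded less_4] ex_b'[unfolded less_4] by auto
    \<comment> \<open>The invariants only read the indices 1 to 3, so resetting index 0 leaves them
      unchanged.\<close>
    have "invariants_4 a = invariants_4 b"
      using invariants_4_eqI[OF 3 D] by (simp add: invariants_4_def)
    then have "equiv_coeffs a b \<or> equiv_coeffs (hat a) b"
      using b0 nz by (intro equiv_coeffs_4[OF 3]) auto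
    \<comment> \<open>For \<open>n = 4\<close> the matrix only has to be invertible, so the identity
      serves as witness.\<close>
    moreover have "invertible (Finite_Cartesian_Product.mat 1 :: 'a ^ 2 ^ 2)"
      by (auto simp: invertible_def intro: exI[of _ "Finite_Cartesian_Product.mat 1"])
    ultimately show ?thesis
      using equiv equiv_hat 3 by auto
  qed
qed

end
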